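(* Let $X=\mathrm{Sp}_{2n}(2)$ with $n\ge2$, and let $\Gamma$ be an $X$-strongly incidence-transitive code in $J(\mathcal{Q}^\epsilon,k)$ for some $k$ with $2\le k\le|\mathcal{Q}^\epsilon|-2$, such that the stabiliser $X_\Delta$ of a codeword $\Delta\in\Gamma$ is irreducible on $V$. Then $X_\Delta$ is not contained in a maximal $\mathcal C_3$-subgroup of $X$.
   Context: $V=\mathbb{F}_2^{2n}$ with symplectic form $B$, $X=\mathrm{Sp}_{2n}(2)$ its isometry group. $\mathcal{Q}^\epsilon$ is the set of quadratic forms $\phi:V\to\mathbb{F}_2$ of type $\epsilon\in\{+,-\}$ with $\phi(x+y)+\phi(x)+\phi(y)=B(x,y)$, $|\mathcal{Q}^\epsilon|=2^{n-1}(2^n+\epsilon)$; $X$ acts by $\phi^g(x)=\phi(xg^{-1})$. A code in $J(\mathcal{Q}^\epsilon,k)$ is a nonempty set of $k$-subsets of $\mathcal{Q}^\epsilon$; $X$-strongly incidence-transitive means $X$ preserves $\Gamma$, is transitive on it, and each $X_\Delta$ is transitive on $\Delta\times(\mathcal{Q}^\epsilon\setminus\Delta)$. Irreducible: no nonzero proper invariant subspace of $V$. A maximal $\mathcal C_3$-subgroup of $X$: for a prime $b$ with $n=mb$, regard $V$ as the underlying $\mathbb{F}_2$-space of a $2m$-dimensional $\mathbb{F}_{2^b}$-space $W$ with symplectic form $\tilde B$ such that $B=\mathrm{Tr}\circ\tilde B$ (absolute trace); the subgroup is the group of additive bijections $g$ of $W$ for which some $\sigma\in\mathrm{Aut}(\mathbb{F}_{2^b})$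 satisfies $(\alpha w)g=\alpha^\sigma(wg)$ and $\tilde B(ug,vg)=\tilde B(u,v)^\sigma$ (isomorphic to $\mathrm{Sp}_{2m}(2^b)\rtimes C_b$). *)

theory Defs
  imports
    "HOL-Analysis.Cartesian_Space"
    "HOL-Library.Z2"
    "HOL-Computational_Algebra.Primes"
begin

definition symplectic_form ::
  "('k::field \<Rightarrow> 'v::ab_group_add \<Rightarrow> 'v) \<Rightarrow> ('v \<Rightarrow> 'v \<Rightarrow> 'k) \<Rightarrow> bool" where
  "symplectic_form smul B \<longleftrightarrow>
     (\<forall>u. Vector_Spaces.linear smul (*) (\<lambda>v. B u v)) \<and>
     (\<forall>v. Vector_Spaces.linear smul (*) (\<lambda>u. B u v)) \<and>
     (\<forall>v. B v v = 0) \<and>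
     (\<forall>u. (\<forall>v. B u v = 0) \<longrightarrow> u = 0)"

definition isometry_group :: "(bit^'d \<Rightarrow> bit^'d \<Rightarrow> bit) \<Rightarrow> (bit^'d \<Rightarrow> bit^'d) set" where
  "isometry_group B =
     {g. Vector_Spaces.linear (*s) (*s) g \<and> bij g \<and> (\<forall>u v. B (g u) (g v) = B u v)}"

definition polarises_to :: "(bit^'d \<Rightarrow> bit) \<Rightarrow> (bit^'d \<Rightarrow> bit^'d \<Rightarrow> bit) \<Rightarrow> bool" where
  "polarises_to \<phi> B \<longleftrightarrow>
     (\<forall>c x. \<phi> (c *s x) = c\<^sup>2 * \<phi> x) \<and> (\<forall>x y. \<phi> (x + y) + \<phi> x + \<phi> y = B x y)"

definition totally_singular :: "(bit^'d \<Rightarrow> bit) \<Rightarrow> (bit^'d) set \<Rightarrow> bool" where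
  "totally_singular \<phi> U \<longleftrightarrow> vec.subspace U \<and> (\<forall>u\<in>U. \<phi> u = 0)"

definition witt_index :: "(bit^'d \<Rightarrow> bit) \<Rightarrow> nat" where
  "witt_index \<phi> = Max {vec.dim U | U. totally_singular \<phi> U}"

datatype form_type = PlusType | MinusType

text \<open>On a space of dimension \<open>2n\<close>, the Witt index is \<open>n\<close> for type \<open>+\<close> and \<open>n - 1\<close> for
  type \<open>-\<close>.\<close>

fun has_type :: "(bit^'d \<Rightarrow> bit) \<Rightarrow> form_type \<Rightarrow> bool" where
  "has_type (\<phi> :: bit^'d \<Rightarrow> bit) PlusType \<longleftrightarrow> CARD('d) = 2 * witt_index \<phi>"
| "has_type (\<phi> :: bit^'d \<Rightarrow> bit) MinusType \<longleftrightarrow> CARD('d) = 2 * (witt_index \<phi> + 1)"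

definition quadratic_forms ::
  "(bit^'d \<Rightarrow> bit^'d \<Rightarrow> bit) \<Rightarrow> form_type \<Rightarrow> (bit^'d \<Rightarrow> bit) set" where
  "quadratic_forms B \<epsilon> = {\<phi>. polarises_to \<phi> B \<and> has_type \<phi> \<epsilon>}"

text \<open>The right action \<open>x g\<close> of a group element on a vector is written \<open>g x\<close> here.\<close>

definition form_act :: "('v \<Rightarrow> 'v) \<Rightarrow> ('v \<Rightarrow> 'k) \<Rightarrow> ('v \<Rightarrow> 'k)" where
  "form_act g \<phi> = (\<lambda>x. \<phi> (inv g x))"

definition set_stabiliser :: "('v \<Rightarrow> 'v) set \<Rightarrow> ('v \<Rightarrow> 'k) set \<Rightarrow> ('v \<Rightarrow> 'v) set" where
  "set_stabiliser G \<Delta> = {g \<in> G. form_act g ` \<Delta> = \<Delta>}"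

definition johnson_code :: "'a set \<Rightarrow> nat \<Rightarrow> 'a set set \<Rightarrow> bool" where
  "johnson_code Q k \<Gamma> \<longleftrightarrow> \<Gamma> \<noteq> {} \<and> (\<forall>\<Delta>\<in>\<Gamma>. \<Delta> \<subseteq> Q \<and> finite \<Delta> \<and> card \<Delta> = k)"

definition strongly_incidence_transitive ::
  "('v \<Rightarrow> 'v) set \<Rightarrow> ('v \<Rightarrow> 'k) set \<Rightarrow> ('v \<Rightarrow> 'k) set set \<Rightarrow> bool" where
  "strongly_incidence_transitive G Q \<Gamma> \<longleftrightarrow>
     (\<forall>g\<in>G. \<forall>\<Delta>\<in>\<Gamma>. form_act g ` \<Delta> \<in> \<Gamma>) \<and>
     (\<forall>\<Delta>\<in>\<Gamma>. \<forall>\<Delta>'\<in>\<Gamma>. \<exists>g\<in>G. form_act g ` \<Delta> = \<Delta>') \<and>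
     (\<forall>\<Delta>\<in>\<Gamma>. \<forall>(\<phi>, \<psi>) \<in> \<Delta> \<times> (Q - \<Delta>). \<forall>(\<phi>', \<psi>') \<in> \<Delta> \<times> (Q - \<Delta>).
        \<exists>g\<in>set_stabiliser G \<Delta>. form_act g \<phi> = \<phi>' \<and> form_act g \<psi> = \<psi>')"

definition irreducible_on_space :: "(bit^'d \<Rightarrow> bit^'d) set \<Rightarrow> bool" where
  "irreducible_on_space G \<longleftrightarrow>
     (\<forall>U. vec.subspace U \<and> (\<forall>g\<in>G. g ` U \<subseteq> U) \<longrightarrow> U = {0} \<or> U = UNIV)"

definition field_automorphism :: "('q::field \<Rightarrow> 'q) \<Rightarrow> bool" where
  "field_automorphism \<sigma> \<longleftrightarrow>
     bij \<sigma> \<and> \<sigma> 1 = 1 \<and> (\<forall>a b. \<sigma> (a + b) = \<sigma> a + \<sigma> b) \<and> (\<forall>a b. \<sigma> (a * b) = \<sigma> a * \<sigma> b)"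

definition semisymplectic_group ::
  "('q::field \<Rightarrow> 'v::ab_group_add \<Rightarrow> 'v) \<Rightarrow> ('v \<Rightarrow> 'v \<Rightarrow> 'q) \<Rightarrow> ('v \<Rightarrow> 'v) set" where
  "semisymplectic_group smul Bt =
     {g. bij g \<and> (\<forall>u v. g (u + v) = g u + g v) \<and>
         (\<exists>\<sigma>. field_automorphism \<sigma> \<and>
              (\<forall>a w. g (smul a w) = smul (\<sigma> a) (g w)) \<and>
              (\<forall>u v. Bt (g u) (g v) = \<sigma> (Bt u v)))}"

text \<open>The absolute trace of the field with \<open>2^b\<close> elements, as an element of that field; its
  values lie in the prime field, which is the image of \<^const>\<open>of_bool\<close>.\<close>

definition absolute_trace :: "nat \<Rightarrow> 'q::field \<Rightarrow> 'q" where
  "absolute_trace b x = (\<Sum>i<b. x ^ (2 ^ i))"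

text \<open>The type \<open>'q\<close>, passed as the phantom argument, plays the role of the field with \<open>2^b\<close>
  elements, and \<open>smul\<close> turns the additive group of \<open>bit^'d\<close> into a vector space over it.\<close>

definition maximal_C3_subgroup ::
  "'q::{field,finite} itself \<Rightarrow> (bit^'d \<Rightarrow> bit^'d \<Rightarrow> bit) \<Rightarrow> (bit^'d \<Rightarrow> bit^'d) set \<Rightarrow> bool" where
  "maximal_C3_subgroup F B H \<longleftrightarrow>
     (\<exists>(b::nat) (m::nat) (smul :: 'q \<Rightarrow> bit^'d \<Rightarrow> bit^'d) (Bt :: bit^'d \<Rightarrow> bit^'d \<Rightarrow> 'q).
        prime b \<and> CARD('d) = 2 * (m * b) \<and> CARD('q) = 2 ^ b \<and>
        vector_space smul \<and> vector_space.dim smul (UNIV :: (bit^'d) set) = 2 * m \<and>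
        symplectic_form smul Bt \<and>
        (\<forall>u v. of_bit (B u v) = absolute_trace b (Bt u v)) \<and>
        H = semisymplectic_group smul Bt)"

end

theory Submission
  imports Defs
begin

text \<open>Forms polarising to \<open>B = Tr \<circ> Bt\<close> lift uniquely to quadratic forms over the extension field \<open>F\<close>
  polarising to \<open>Bt\<close>, and any two of them differ by a shift \<open>\<phi> + B(\<cdot>, w)\<close>. The value of the lift of
  \<open>\<phi>\<close> at \<open>w\<close>, up to field automorphisms, is an invariant (the colour) of the pair under semilinear
  isometries, so by transitivity all pairs between a codeword and its complement have the same colour.
  The colour has trace 0, for otherwise every transvection would stabilise the codeword, while no
  transvection is \<open>F\<close>-semilinear. A colour different from that of the cross pairs never crosses between
  codeword and complement, and paths of length two with colours of our choice show that the colour is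
  not 0 and that no lift has a singular vector. Then \<open>V\<close> is a plane over \<open>F\<close>. For
  \<open>card F = 4\<close> some transvection acts on the forms as a transposition inside the codeword. Otherwise
  the stabiliser of two forms has order at most 2, and the resulting divisibilities
  \<open>e dvd 2 (d - 1)\<close>, \<open>d dvd 2 (e - 1)\<close> between the sizes \<open>d\<close>, \<open>e\<close> of the codeword and its complement
  leave at most 16 forms, too few on a space with at least 64 vectors.\<close>

section \<open>Characters of finite elementary abelian 2-groups\<close>

text \<open>Keeps sums and products of bits in ring notation, where additivity and cancellation
  apply.\<close>

declare add_bit_eq_xor [simp del] mult_bit_eq_and [simp del]

lemma bit_add_self [simp]: "a + a = (0::bit)"
  by (cases a) simp_all

lemma bit_add_left_cancel [simp]: "a + (a + c) = (c::bit)"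
  by (simp flip: add.assoc)

lemma bit_add_eq_0_iff: "a + c = 0 \<longleftrightarrow> a = (c::bit)"
  by (cases a; cases c) simp_all

text \<open>Makes \<open>bit^'d\<close> a finite type, as sums over all vectors require.\<close>

instance bit :: finite
proof
  have "(UNIV :: bit set) = {0, 1}" by auto
  then show "finite (UNIV :: bit set)" by (metis finite.emptyI finite.insertI)
qed

text \<open>The nontrivial additive character of the prime field, with integer values.\<close>

definition bit_sign :: "bit \<Rightarrow> int" where
  "bit_sign a = (if a = 0 then 1 else -1)"

lemma bit_sign_add: "bit_sign (a + c) = bit_sign a * bit_sign c"
  by (cases a; cases c) (simp_all add: bit_sign_def)

lemma bit_sign_0 [simp]: "bit_sign 0 = 1"
  by (simp add: bit_sign_def)

lemma sum_translate:
  fixes f :: "'a::{ab_group_add,finite} \<Rightarrow> 'b::comm_monoid_add"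
  shows "(\<Sum>x\<in>UNIV. f (x + a)) = (\<Sum>x\<in>UNIV. f x)"
  by (rule sum.reindex_bij_witness[of _ "\<lambda>x. x - a" "\<lambda>x. x + a"]) auto

text \<open>Orthogonality of characters: translation by a point where \<open>h\<close> is 1 keeps
  the sum and reverses its sign.\<close>

lemma sum_bit_sign_additive:
  fixes h :: "'a::{ab_group_add,finite} \<Rightarrow> bit"
  assumes add: "\<And>x y. h (x + y) = h x + h y"
  shows "(\<Sum>x\<in>UNIV. bit_sign (h x)) = (if \<forall>x. h x = 0 then int CARD('a) else 0)"
proof (cases "\<forall>x. h x = 0")
  case False
  then obtain a where a: "h a = 1" by auto
  have "(\<Sum>x\<in>UNIV. bit_sign (h x)) = (\<Sum>x\<in>UNIV. bit_sign (h (x + a)))"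
    by (rule sum_translate[symmetric])
  also have "\<dots> = - (\<Sum>x\<in>UNIV. bit_sign (h x))"
    by (simp add: add a bit_sign_add sum_negf) (simp add: bit_sign_def sum_negf)
  finally show ?thesis using False by simp
qed simp

text \<open>Instantiated twice: by \<open>tr (x * y)\<close> on the extension field, to lift forms,
  and by \<open>B\<close> on the space, to compare and count forms.\<close>

locale perfect_pairing =
  fixes \<beta> :: "'a::{ab_group_add,finite} \<Rightarrow> 'a \<Rightarrow> bit"
  assumes add_left: "\<beta> (x + y) z = \<beta> x z + \<beta> y z"
    and add_right: "\<beta> z (x + y) = \<beta> z x + \<beta> z y"
    and sym: "\<beta> x y = \<beta> y x"
    and nondeg: "(\<And>y. \<beta> x y = 0) \<Longrightarrow> x = 0"
begin

lemma zero_left [simp]: "\<beta> 0 y = 0"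
  using add_left[of 0 0 y] by simp

lemma sum_bit_sign:
  "(\<Sum>y\<in>UNIV. bit_sign (\<beta> x y)) = (if x = 0 then int CARD('a) else 0)"
proof -
  have "(\<forall>y. \<beta> x y = 0) \<longleftrightarrow> x = 0"
    using nondeg by auto
  then show ?thesis
    using sum_bit_sign_additive[of "\<beta> x"] by (simp add: add_right)
qed

text \<open>Every additive map is represented: its Fourier transform sums to a nonzero value, hence
  is nonzero somewhere, and there the product with the character is trivial.\<close>

lemma additive_represented:
  fixes f :: "'a \<Rightarrow> bit"
  assumes f: "\<And>x y. f (x + y) = f x + f y"
  obtains c where "\<And>x. f x = \<beta> x c"
proof -
  have f0: "f 0 = 0" using f[of 0 0] by simp
  have "(\<Sum>c\<in>UNIV. \<Sum>x\<in>UNIV. bit_sign (f x + \<beta> x c))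
      = (\<Sum>x\<in>UNIV. bit_sign (f x) * (\<Sum>c\<in>UNIV. bit_sign (\<beta> x c)))"
    by (subst sum.swap) (simp add: bit_sign_add sum_distrib_left)
  also have "\<dots> = (\<Sum>x\<in>UNIV. if x = (0::'a) then int CARD('a) else 0)"
    by (intro sum.cong refl) (simp add: sum_bit_sign f0)
  also have "\<dots> = int CARD('a)" by (simp add: sum.delta)
  finally have "(\<Sum>c\<in>UNIV. \<Sum>x\<in>UNIV. bit_sign (f x + \<beta> x c)) \<noteq> 0" by simp
  then obtain c where c: "(\<Sum>x\<in>UNIV. bit_sign (f x + \<beta> x c)) \<noteq> 0"
    by (meson sum.not_neutral_contains_not_neutral)
  have "\<forall>x. f x + \<beta> x c = 0"
  proof (rule ccontr)
    assume "\<not> (\<forall>x. f x + \<beta> x c = 0)"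
    moreover have "(\<Sum>x\<in>UNIV. bit_sign (f x + \<beta> x c))
        = (if \<forall>x. f x + \<beta> x c = 0 then int CARD('a) else 0)"
      by (rule sum_bit_sign_additive) (simp add: f add_left ac_simps)
    ultimately show False using c by presburger
  qed
  then show thesis using that by (simp add: bit_add_eq_0_iff)
qed

text \<open>A Gauss sum: replacing \<open>y\<close> by \<open>y + x\<close> in the double sum
  cancels \<open>\<phi> x\<close>, and the sum over \<open>x\<close> is then a character sum that
  vanishes unless \<open>y = 0\<close>.\<close>

lemma quadratic_sum_square:
  assumes q: "\<And>x y. \<phi> (x + y) = \<phi> x + \<phi> y + \<beta> x y"
  shows "(\<Sum>x\<in>UNIV. bit_sign (\<phi> x))\<^sup>2 = int CARD('a)"
proof -
  have q0: "\<phi> 0 = 0" using q[of 0 0] by simp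
  have "(\<Sum>x\<in>UNIV. bit_sign (\<phi> x))\<^sup>2
      = (\<Sum>x\<in>UNIV. bit_sign (\<phi> x) * (\<Sum>y\<in>UNIV. bit_sign (\<phi> y)))"
    by (simp add: power2_eq_square sum_distrib_right)
  also have "\<dots> = (\<Sum>x\<in>UNIV. bit_sign (\<phi> x) * (\<Sum>y\<in>UNIV. bit_sign (\<phi> (y + x))))"
    by (subst sum_translate[of "\<lambda>y. bit_sign (\<phi> y)"]) simp
  also have "\<dots> = (\<Sum>x\<in>UNIV. \<Sum>y\<in>UNIV. bit_sign (\<phi> y) * bit_sign (\<beta> y x))"
    unfolding sum_distrib_left
    by (intro sum.cong refl) (simp add: q sym ac_simps flip: bit_sign_add)
  also have "\<dots> = (\<Sum>y\<in>UNIV. bit_sign (\<phi> y) * (\<Sum>x\<in>UNIV. bit_sign (\<beta> y x)))"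
    by (subst sum.swap) (simp add: sum_distrib_left)
  also have "\<dots> = (\<Sum>y\<in>UNIV. if y = (0::'a) then int CARD('a) else 0)"
    by (intro sum.cong refl) (simp add: sum_bit_sign q0)
  also have "\<dots> = int CARD('a)" by (simp add: sum.delta)
  finally show ?thesis .
qed

text \<open>With \<open>z\<close> zeros among \<open>N\<close> vectors the Gauss sum is
  \<open>2 * z - N\<close>, of square \<open>N\<close>. For \<open>z \<le> 16\<close> and
  \<open>64 \<le> N\<close> the square would be at least \<open>(N - 32)\<^sup>2\<close>, which
  exceeds \<open>N\<close>.\<close>

lemma card_zeros_quadratic:
  assumes "\<And>x y. \<phi> (x + y) = \<phi> x + \<phi> y + \<beta> x y"
    and "64 \<le> CARD('a)"
  shows "16 < card {x. \<phi> x = 0}"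
proof (rule ccontr)
  define z where "z = card {x. \<phi> x = 0}"
  define N where "N = int CARD('a)"
  assume "\<not> 16 < card {x. \<phi> x = 0}"
  then have z: "int z \<le> 16" by (simp add: z_def)
  have "(\<Sum>x\<in>UNIV. bit_sign (\<phi> x)) = (\<Sum>x\<in>UNIV. 2 * of_bool (\<phi> x = 0) - 1)"
    by (rule sum.cong) (auto simp: bit_sign_def)
  also have "\<dots> = 2 * int z - N"
    by (simp add: z_def N_def sum_subtractf flip: sum_distrib_left)
  finally have sq: "(2 * int z - N)\<^sup>2 = N"
    using quadratic_sum_square[OF assms(1)] by (simp add: N_def)
  have N: "N \<ge> 64" using assms(2) by (simp add: N_def)
  have "N - 2 * int z \<ge> N - 32" using z by simp
  then have "(N - 32) * (N - 32) \<le> (N - 2 * int z) * (N - 2 * int z)"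
    using N by (intro mult_mono) auto
  also have "\<dots> = N" using sq by (simp add: power2_eq_square algebra_simps)
  finally have "(N - 32) * (N - 32) \<le> N" .
  moreover have "(N - 32) * 32 \<le> (N - 32) * (N - 32)" using N by (intro mult_left_mono) auto
  ultimately show False using N by simp
qed

end

section \<open>The field and its trace\<close>

text \<open>Multiplication by \<open>x \<noteq> 0\<close> permutes the nonzero elements, so their
  product absorbs the factor \<open>x ^ (CARD('q) - 1)\<close>.\<close>

lemma finite_field_power_CARD:
  fixes x :: "'q::{field,finite}"
  shows "x ^ CARD('q) = x"
proof (cases "x = 0")
  case True
  then show ?thesis by simp
next
  case False
  have "\<Prod>(UNIV - {0}) = (\<Prod>y\<in>UNIV - {0}. x * y)"
    by (rule prod.reindex_bij_witness[of _ "\<lambda>y. x * y" "\<lambda>y. y / x"]) (use False in auto)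
  also have "\<dots> = x ^ (CARD('q) - 1) * \<Prod>(UNIV - {0})"
    by (simp add: prod.distrib)
  finally have "x ^ (CARD('q) - 1) = 1" by simp
  then have "x * x ^ (CARD('q) - 1) = x" by simp
  then show ?thesis
    by (metis One_nat_def Suc_pred finite_UNIV_card_ge_0 finite_class.finite_UNIV power_Suc)
qed

text \<open>Euclidean descent on \<open>c\<close>: modulo \<open>2 ^ a - 1\<close>, the number
  \<open>2 ^ c - 1\<close> is congruent to \<open>2 ^ (c - a) - 1\<close>.\<close>

lemma power_minus_1_dvd_imp_dvd:
  fixes a c :: nat
  assumes "a > 0" "(2::nat) ^ a - 1 dvd 2 ^ c - 1"
  shows "a dvd c"
  using assms(2)
proof (induction c rule: less_induct)
  case (less c)
  show ?case
  proof (cases "c < a")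
    case True
    then have "(2::nat) ^ c - 1 < 2 ^ a - 1"
      by (simp add: diff_less_mono)
    then have "(2::nat) ^ c - 1 = 0"
      using less.prems dvd_imp_le by fastforce
    then have "c = 0"
      by (metis One_nat_def Suc_leI diff_is_0_eq le_antisym nat_power_eq_Suc_0_iff numeral_One
          numeral_eq_iff one_le_numeral one_le_power semiring_norm(85))
    then show ?thesis by simp
  next
    case False
    define e where "e = c - a"
    have c: "c = a + e" using False by (simp add: e_def)
    have "(2::nat) ^ c - 1 = 2 ^ e * (2 ^ a - 1) + (2 ^ e - 1)"
      by (simp add: c power_add algebra_simps diff_mult_distrib2)
    then have "(2::nat) ^ a - 1 dvd 2 ^ e - 1"
      using less.prems by (metis dvd_add_right_iff dvd_triv_right)
    then have "a dvd e" using less.IH assms(1) c by simp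
    then show ?thesis using c by simp
  qed
qed

lemma field_automorphismD:
  assumes "field_automorphism \<sigma>"
  shows "bij \<sigma>" "\<sigma> 1 = 1" "\<sigma> 0 = 0" "\<sigma> (a + c) = \<sigma> a + \<sigma> c" "\<sigma> (a * c) = \<sigma> a * \<sigma> c"
    "\<sigma> (a ^ i) = \<sigma> a ^ i"
proof -
  show *: "bij \<sigma>" "\<sigma> 1 = 1" "\<sigma> (a + c) = \<sigma> a + \<sigma> c" "\<And>a c. \<sigma> (a * c) = \<sigma> a * \<sigma> c"
    using assms by (auto simp: field_automorphism_def)
  show "\<sigma> 0 = 0"
    using assms by (metis add_cancel_right_right field_automorphism_def)
  show "\<sigma> (a ^ i) = \<sigma> a ^ i" by (induction i) (simp_all add: *)
qed

text \<open>A field of prime degree over its prime field has no intermediate fields: if \<open>K\<close> is the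
  fixed field then \<open>card K = 2 ^ a\<close> and \<open>card K - 1\<close> divides \<open>2 ^ b - 1\<close>.\<close>

lemma field_automorphism_trivial:
  fixes \<sigma> :: "'q::{field,finite} \<Rightarrow> 'q"
  assumes \<sigma>: "field_automorphism \<sigma>" and b: "prime b" "CARD('q) = 2 ^ b"
    and c: "\<sigma> c = c" "c \<noteq> 0" "c \<noteq> 1"
  shows "\<sigma> = id"
proof -
  note D = field_automorphismD[OF \<sigma>]
  define K where "K = {x. \<sigma> x = x}"
  have neg: "\<sigma> (- x) = - \<sigma> x" for x
    using D(4)[of x "- x"] D(3) by (simp add: eq_neg_iff_add_eq_0 add.commute)
  have inv: "\<sigma> (x / y) = \<sigma> x / \<sigma> y" for x y
  proof (cases "y = 0")
    case False
    then have "\<sigma> y \<noteq> 0" using D(1,3) by (metis bij_pointE)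
    then show ?thesis
      using D(5)[of "x / y" y] False by (simp add: field_simps)
  qed (simp add: D)
  have K: "0 \<in> K" "1 \<in> K" "c \<in> K" "\<And>x y. x \<in> K \<Longrightarrow> y \<in> K \<Longrightarrow> x + y \<in> K"
    "\<And>x y. x \<in> K \<Longrightarrow> y \<in> K \<Longrightarrow> x - y \<in> K" "\<And>x y. x \<in> K \<Longrightarrow> y \<in> K \<Longrightarrow> x * y \<in> K"
    "\<And>x y. x \<in> K \<Longrightarrow> y \<in> K \<Longrightarrow> x / y \<in> K"
    using c(1) D(4)[of _ "- _"] by (auto simp: K_def D neg inv)
  \<comment> \<open>The additive cosets of \<open>K\<close> partition the field, so
    \<open>card K\<close> is a power of 2.\<close>
  have "card K dvd card (\<Union>x. (+) x ` K)"
  proof (rule dvd_partition)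
    show "\<forall>A\<in>range (\<lambda>x. (+) x ` K). card K dvd card A"
      by (auto simp: card_image)
    have "(+) x ` K \<subseteq> (+) y ` K" if "x + k = y + l" "k \<in> K" "l \<in> K" for x y k l
    proof
      fix z assume "z \<in> (+) x ` K"
      then obtain j where j: "j \<in> K" "z = x + j" by auto
      then have "z = y + (l - k + j)" using that(1) by (simp add: algebra_simps)
      then show "z \<in> (+) y ` K" using K j that by blast
    qed
    then show "\<forall>A\<in>range (\<lambda>x. (+) x ` K). \<forall>A'\<in>range (\<lambda>x. (+) x ` K).
        A \<noteq> A' \<longrightarrow> A \<inter> A' = {}"
      by (smt (verit, ccfv_threshold) disjoint_iff imageE subset_antisym)
  qed simp
  moreover have "(\<Union>x. (+) x ` K) = UNIV" using K(1) by force
  ultimately have "card K dvd 2 ^ b" using b by simp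
  then obtain a where a: "card K = 2 ^ a"
    using divides_primepow_nat[OF two_is_prime_nat] by blast
  \<comment> \<open>Likewise the multiplicative cosets of \<open>K - {0}\<close> partition the
    nonzero elements.\<close>
  have "card (K - {0}) dvd card (\<Union>x\<in>UNIV - {0}. (*) x ` (K - {0}))"
  proof (rule dvd_partition)
    show "\<forall>A\<in>(\<lambda>x. (*) x ` (K - {0})) ` (UNIV - {0}). card (K - {0}) dvd card A"
      by (auto simp: card_image inj_on_def)
    have "(*) x ` (K - {0}) \<subseteq> (*) y ` (K - {0})"
      if "x * k = y * l" "k \<in> K - {0}" "l \<in> K - {0}" for x y k l
    proof
      fix z assume "z \<in> (*) x ` (K - {0})"
      then obtain j where j: "j \<in> K - {0}" "z = x * j" by auto
      then have "z = y * (l / k * j)" using that by (simp add: field_simps)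
      moreover have "l / k * j \<in> K - {0}" using K j that by simp
      ultimately show "z \<in> (*) y ` (K - {0})" by blast
    qed
    then show "\<forall>A\<in>(\<lambda>x. (*) x ` (K - {0})) ` (UNIV - {0}).
        \<forall>A'\<in>(\<lambda>x. (*) x ` (K - {0})) ` (UNIV - {0}). A \<noteq> A' \<longrightarrow> A \<inter> A' = {}"
      by (smt (verit, ccfv_threshold) disjoint_iff imageE subset_antisym)
  qed simp
  moreover have "(\<Union>x\<in>UNIV - {0}. (*) x ` (K - {0})) = UNIV - {0}"
    using K(2) by force
  ultimately have "2 ^ a - 1 dvd (2::nat) ^ b - 1"
    using K(1) by (simp add: a b card_Diff_singleton)
  \<comment> \<open>The element \<open>c\<close> shows that \<open>K\<close> is larger than the
    prime field, so the divisor \<open>a\<close> of the prime \<open>b\<close> exceeds 1.\<close>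
  moreover have "2 < card K"
  proof -
    have "{0, 1, c} \<subseteq> K" using K by simp
    then have "card {0, 1, c} \<le> card K" by (intro card_mono) simp_all
    then show ?thesis using c by simp
  qed
  ultimately have "a dvd b" "a > 1"
    using power_minus_1_dvd_imp_dvd[of a b] a by (cases "a = 0"; cases "a = 1"; simp)+
  then have "a = b" using b(1) by (metis nat_neq_iff prime_nat_iff)
  then have "K = UNIV" using a b(2) by (metis card_subset_eq finite_class.finite_UNIV subset_UNIV)
  then have "\<sigma> x = x" for x by (auto simp: K_def)
  then show ?thesis by auto
qed

lemma card_eq_card_kernel_times_card_range:
  fixes f :: "'a::{ab_group_add,finite} \<Rightarrow> 'b::ab_group_add"
  assumes f: "\<And>x y. f (x + y) = f x + f y"
  shows "CARD('a) = card {x. f x = 0} * card (range f)"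
proof -
  have fd: "f (x - y) = f x - f y" for x y
    using f[of "x - y" y] by (simp add: algebra_simps)
  have fibre: "card {x. f x = f a} = card {x. f x = 0}" for a
    by (rule bij_betw_same_card[of "\<lambda>x. x - a"])
       (rule bij_betw_byWitness[of _ "\<lambda>x. x + a"], auto simp: f fd)
  have "CARD('a) = (\<Sum>x\<in>(UNIV::'a set). 1)" by simp
  also have "\<dots> = (\<Sum>y\<in>range f. \<Sum>x\<in>{x. x \<in> UNIV \<and> f x = y}. 1)"
    by (rule sum.image_gen) simp
  also have "\<dots> = (\<Sum>y\<in>range f. card {x. f x = 0})"
    by (rule sum.cong) (auto simp: fibre)
  finally show ?thesis by simp
qed

lemma symplectic_formD:
  assumes "symplectic_form s \<beta>"
  shows "\<beta> (x + y) z = \<beta> x z + \<beta> y z" "\<beta> z (x + y) = \<beta> z x + \<beta> z y"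
    "\<beta> (s a x) z = a * \<beta> x z" "\<beta> z (s a x) = a * \<beta> z x"
    "\<beta> x x = 0" "(\<And>y. \<beta> x y = 0) \<Longrightarrow> x = 0"
proof -
  interpret R: Vector_Spaces.linear s "(*)" "\<lambda>v. \<beta> u v" for u
    using assms by (simp add: symplectic_form_def)
  interpret L: Vector_Spaces.linear s "(*)" "\<lambda>v. \<beta> v u" for u
    using assms by (simp add: symplectic_form_def)
  show "\<beta> (x + y) z = \<beta> x z + \<beta> y z" "\<beta> z (x + y) = \<beta> z x + \<beta> z y"
    "\<beta> (s a x) z = a * \<beta> x z" "\<beta> z (s a x) = a * \<beta> z x"
    by (simp_all add: R.add L.add R.scale L.scale)
  show "\<beta> x x = 0" "(\<And>y. \<beta> x y = 0) \<Longrightarrow> x = 0"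
    using assms by (auto simp: symplectic_form_def)
qed

section \<open>Symplectic spaces over an extension field and their trace form\<close>

locale symplectic_trace_space =
  fixes smul :: "'q::{field,finite} \<Rightarrow> bit^'d \<Rightarrow> bit^'d" (infixr "\<odot>" 75)
    and Bt :: "bit^'d \<Rightarrow> bit^'d \<Rightarrow> 'q" and B :: "bit^'d \<Rightarrow> bit^'d \<Rightarrow> bit" and b :: nat
  assumes prime_b: "prime b" and card_q: "CARD('q) = 2 ^ b"
    and vs: "vector_space smul"
    and Bt_symplectic: "symplectic_form smul Bt"
    and B_symplectic: "symplectic_form (*s) B"
    and trace_Bt: "of_bit (B u v) = absolute_trace b (Bt u v)"
begin

text \<open>Translation by 1 permutes the field, yet adds \<open>CARD('q) = 2 ^ b\<close> to the sum
  of all elements; hence \<open>2 ^ b = 0\<close> in the field.\<close>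

lemma q_add_self [simp]: "x + x = (0::'q)"
proof -
  have "(\<Sum>y\<in>UNIV. y + (1::'q)) = (\<Sum>y\<in>UNIV. y)" by (rule sum_translate)
  then have "(2::'q) ^ b = 0" using card_q by (simp add: sum.distrib)
  then have "(2::'q) = 0" by simp
  then show ?thesis by (metis mult_2 mult_zero_left)
qed

lemma q_two_eq_0 [simp]: "(2::'q) = 0"
  using q_add_self[of 1] by (simp only: one_add_one)

lemma q_add_left_cancel [simp]: "x + (x + y) = (y::'q)"
  by (simp flip: add.assoc)

lemma q_add_eq_0_iff: "x + y = (0::'q) \<longleftrightarrow> x = y"
  by (metis q_add_left_cancel add.right_neutral q_add_self)

lemma v_add_self [simp]: "x + x = (0::bit^'d)"
  by (simp add: vec_eq_iff)

lemma v_add_left_cancel [simp]: "x + (x + y) = (y::bit^'d)"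
  by (simp flip: add.assoc)

lemma v_add_eq_0_iff: "x + y = (0::bit^'d) \<longleftrightarrow> x = y"
  by (metis v_add_left_cancel add.right_neutral v_add_self)

lemma q_square_add: "(x + y)\<^sup>2 = x\<^sup>2 + (y::'q)\<^sup>2"
proof -
  have "(x + y)\<^sup>2 = x\<^sup>2 + y\<^sup>2 + (x * y + x * y)"
    by (simp only: power2_eq_square) (simp add: algebra_simps)
  then show ?thesis by simp
qed

lemma q_power_add: "(x + y) ^ (2 ^ i) = x ^ (2 ^ i) + (y::'q) ^ (2 ^ i)"
proof (induction i)
  case (Suc i)
  have *: "z ^ 2 ^ Suc i = (z ^ 2 ^ i)\<^sup>2" for z :: 'q
    by (simp add: mult.commute flip: power_mult)
  show ?case unfolding * Suc q_square_add ..
qed simp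

lemma q_square_eq_iff [simp]: "x\<^sup>2 = y\<^sup>2 \<longleftrightarrow> x = (y::'q)"
proof
  assume "x\<^sup>2 = y\<^sup>2"
  then have "(x + y)\<^sup>2 = 0" by (simp add: q_square_add)
  then show "x = y" by (simp add: q_add_eq_0_iff)
qed simp

lemma ex_sqrt: obtains y :: 'q where "y\<^sup>2 = x"
proof -
  have "inj (\<lambda>y::'q. y\<^sup>2)" by (simp add: inj_def)
  then have "surj (\<lambda>y::'q. y\<^sup>2)" by (simp add: finite_UNIV_inj_surj)
  then show thesis using that by (metis surjD)
qed

lemma Bt_add_left: "Bt (x + y) z = Bt x z + Bt y z"
  and Bt_add_right: "Bt z (x + y) = Bt z x + Bt z y"
  and Bt_scale_left: "Bt (a \<odot> x) z = a * Bt x z"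
  and Bt_scale_right: "Bt z (a \<odot> x) = a * Bt z x"
  and Bt_self [simp]: "Bt x x = 0"
  and Bt_nondeg: "(\<And>y. Bt x y = 0) \<Longrightarrow> x = 0"
  using symplectic_formD[OF Bt_symplectic] by auto

lemma Bt_sym: "Bt x y = Bt y x"
proof -
  have "0 = Bt (x + y) (x + y)" by (rule Bt_self[symmetric])
  also have "\<dots> = Bt x y + Bt y x" unfolding Bt_add_left Bt_add_right by simp
  finally show ?thesis by (simp add: q_add_eq_0_iff)
qed

lemma B_add_left: "B (x + y) z = B x z + B y z"
  and B_add_right: "B z (x + y) = B z x + B z y"
  and B_self [simp]: "B x x = 0"
  and B_nondeg: "(\<And>y. B x y = 0) \<Longrightarrow> x = 0"
  using symplectic_formD[OF B_symplectic] by auto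

lemma B_sym: "B x y = B y x"
proof -
  have "0 = B (x + y) (x + y)" by (rule B_self[symmetric])
  also have "\<dots> = B x y + B y x" unfolding B_add_left B_add_right by simp
  finally show ?thesis by (simp add: bit_add_eq_0_iff)
qed

lemma scale [simp]: "a \<odot> (x + y) = a \<odot> x + a \<odot> y" "(a + c) \<odot> x = a \<odot> x + c \<odot> x"
    "a \<odot> c \<odot> x = (a * c) \<odot> x" "1 \<odot> x = x" "0 \<odot> x = 0" "a \<odot> 0 = 0"
proof -
  interpret vector_space smul by (rule vs)
  show "a \<odot> (x + y) = a \<odot> x + a \<odot> y" "(a + c) \<odot> x = a \<odot> x + c \<odot> x"
    "a \<odot> c \<odot> x = (a * c) \<odot> x" "1 \<odot> x = x" "0 \<odot> x = 0" "a \<odot> 0 = 0"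
    by (simp_all add: scale_right_distrib scale_left_distrib)
qed

lemma scale_eq_0_iff: "a \<odot> x = 0 \<longleftrightarrow> a = 0 \<or> x = 0"
proof -
  interpret vector_space smul by (rule vs)
  show ?thesis by simp
qed

text \<open>By \<open>absolute_trace_01\<close> the only value besides 0 is 1, so no information is
  lost; a value in \<open>bit\<close> can be compared with \<open>B\<close>.\<close>

definition tr :: "'q \<Rightarrow> bit" where
  "tr x = (if absolute_trace b x = 0 then 0 else 1)"

lemma absolute_trace_add: "absolute_trace b (x + y) = absolute_trace b x + absolute_trace b (y::'q)"
  by (simp add: absolute_trace_def q_power_add sum.distrib)

lemma q_square_sum: "(sum f A)\<^sup>2 = (\<Sum>i\<in>A. (f i :: 'q)\<^sup>2)"
  by (induction A rule: infinite_finite_induct) (simp_all add: q_square_add)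

text \<open>Squaring permutes the summands cyclically because \<open>x ^ (2 ^ b) = x\<close>, so the
  trace is idempotent.\<close>

lemma absolute_trace_01: "absolute_trace b (x::'q) = 0 \<or> absolute_trace b x = 1"
proof -
  have "(absolute_trace b x)\<^sup>2 = (\<Sum>i<b. x ^ (2 ^ Suc i))"
    by (simp add: absolute_trace_def q_square_sum mult.commute flip: power_mult)
  also have "\<dots> = (\<Sum>i<Suc b. x ^ (2 ^ i)) - x"
    by (subst sum.lessThan_Suc_shift) simp
  also have "\<dots> = absolute_trace b x"
    using finite_field_power_CARD[of x] by (simp add: absolute_trace_def card_q)
  finally show ?thesis by (simp add: power2_eq_square)
qed

lemma absolute_trace_eq: "absolute_trace b x = of_bit (tr x)"
  using absolute_trace_01[of x] by (auto simp: tr_def)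

lemma tr_eqI: "absolute_trace b x = of_bit c \<Longrightarrow> tr x = c"
  by (cases c) (auto simp: tr_def)

lemma tr_add: "tr (x + y) = tr x + tr y"
  by (rule tr_eqI) (cases "tr x"; cases "tr y"; simp add: absolute_trace_add absolute_trace_eq[of x] absolute_trace_eq[of y])

lemma tr_0 [simp]: "tr 0 = 0"
  using tr_add[of 0 0] by simp

lemma B_eq_tr: "B u v = tr (Bt u v)"
  by (rule sym, rule tr_eqI, rule trace_Bt[symmetric])

lemma tr_power2: "tr (x\<^sup>2) = tr x"
proof -
  have "absolute_trace b (x\<^sup>2) = (absolute_trace b x)\<^sup>2"
    by (simp add: absolute_trace_def q_square_sum mult.commute flip: power_mult)
  also have "\<dots> = absolute_trace b x" using absolute_trace_01[of x] by auto
  finally show ?thesis by (simp add: tr_def)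
qed

lemma tr_automorphism:
  assumes "field_automorphism \<sigma>"
  shows "tr (\<sigma> x) = tr x"
proof -
  note D = field_automorphismD[OF assms]
  have "\<sigma> (sum f A) = (\<Sum>i\<in>A. \<sigma> (f i))" for f and A :: "nat set"
    by (induction A rule: infinite_finite_induct) (simp_all add: D)
  then have "absolute_trace b (\<sigma> x) = \<sigma> (absolute_trace b x)"
    by (simp add: absolute_trace_def D)
  also have "\<dots> = absolute_trace b x" using absolute_trace_01[of x] D by auto
  finally show ?thesis by (simp add: tr_def)
qed

text \<open>If the trace vanished, so would the nondegenerate form \<open>B\<close>. The all-ones
  vector \<open>1\<close> serves as some nonzero vector.\<close>

lemma ex_tr_1: obtains \<theta> where "tr \<theta> = 1"
proof -
  have "(1::bit^'d) \<noteq> 0" by (simp add: vec_eq_iff)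
  then obtain v where "B 1 v \<noteq> 0" using B_nondeg by blast
  then show thesis using that by (auto simp: B_eq_tr)
qed

sublocale tr: perfect_pairing "\<lambda>x y. tr (x * y)"
proof
  fix x :: 'q assume *: "\<And>y. tr (x * y) = 0"
  show "x = 0"
  proof (rule ccontr)
    assume "x \<noteq> 0"
    obtain \<theta> where "tr \<theta> = 1" by (rule ex_tr_1)
    then show False using *[of "\<theta> / x"] \<open>x \<noteq> 0\<close> by simp
  qed
qed (simp_all add: tr_add algebra_simps)

sublocale B: perfect_pairing B
  by unfold_locales (simp_all add: B_add_left B_add_right B_nondeg, rule B_sym)

lemma b_ge_2: "b \<ge> 2" using prime_b by (simp add: prime_ge_2_nat)

lemma card_q_ge_4: "CARD('q) \<ge> 4"
  using power_increasing[OF b_ge_2, of "2::nat"] by (simp add: card_q)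

lemma q_not_only_01: obtains a :: 'q where "a \<noteq> 0" "a \<noteq> 1"
proof -
  have "card {0, 1::'q} < CARD('q)" using card_q_ge_4 by simp
  then have "\<exists>a::'q. a \<notin> {0, 1}" by (metis UNIV_eq_I less_irrefl)
  then show thesis using that by auto
qed

text \<open>Additive Hilbert 90 by counting: \<open>\<mu>\<^sup>2 + \<mu>\<close> has kernel
  \<open>{0, 1}\<close>, so its range is half of the field and lies in the kernel of
  \<open>tr\<close>, which is also half of the field.\<close>

lemma artin_schreier:
  assumes "tr c = 0" obtains \<mu> where "\<mu>\<^sup>2 + \<mu> = c"
proof -
  define f where "f \<mu> = \<mu>\<^sup>2 + \<mu>" for \<mu> :: 'q
  have "\<mu>\<^sup>2 + \<mu> = 0 \<longleftrightarrow> \<mu> \<in> {0, 1}" for \<mu> :: 'q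
    by (auto simp: q_add_eq_0_iff power2_eq_square)
  then have "{\<mu>. f \<mu> = 0} = {0, 1}" by (auto simp: f_def)
  then have 1: "2 * card (range f) = CARD('q)"
    using card_eq_card_kernel_times_card_range[of f]
    by (simp add: f_def q_square_add algebra_simps)
  have "range tr = {0, 1}"
    using ex_tr_1 tr_0 by (smt (verit) bit.exhaust UNIV_eq_I insertCI rangeI subset_antisym subset_iff)
  then have 2: "2 * card {x. tr x = 0} = CARD('q)"
    using card_eq_card_kernel_times_card_range[of tr] by (simp add: tr_add)
  have "range f \<subseteq> {x. tr x = 0}" by (auto simp: f_def tr_add tr_power2)
  then have "range f = {x. tr x = 0}" using 1 2 by (intro card_subset_eq) auto
  then have "c \<in> range f" using assms by simp
  then show thesis using that unfolding f_def by blast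
qed

lemma ex_tr_0: obtains d where "tr d = 0" "d \<noteq> 0"
proof -
  obtain a :: 'q where "a \<noteq> 0" "a \<noteq> 1" by (rule q_not_only_01)
  then have "a\<^sup>2 + a \<noteq> 0" by (simp add: q_add_eq_0_iff power2_eq_square)
  moreover have "tr (a\<^sup>2 + a) = 0" by (simp add: tr_add tr_power2)
  ultimately show thesis using that by blast
qed

end

section \<open>Isometries acting on forms\<close>

text \<open>The only scalars are 0 and 1, so homogeneity follows from additivity.\<close>

lemma linear_bit_iff:
  "Vector_Spaces.linear ((*s) :: bit \<Rightarrow> bit^'d \<Rightarrow> bit^'d) ((*s) :: bit \<Rightarrow> bit^'e \<Rightarrow> bit^'e) g
    \<longleftrightarrow> (\<forall>x y. g (x + y) = g x + g y)"
proof -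
  have "g (c *s x) = c *s g x" if "\<forall>x y. g (x + y) = g x + g y" for c x
  proof -
    have "g 0 = 0" using that by (metis add_cancel_right_right)
    then show ?thesis by (cases c) simp_all
  qed
  then show ?thesis
    by (auto simp: Vector_Spaces.linear_iff vec.vector_space_axioms)
qed

lemma isometry_group_iff:
  "g \<in> isometry_group B \<longleftrightarrow> bij g \<and> (\<forall>x y. g (x + y) = g x + g y) \<and> (\<forall>u v. B (g u) (g v) = B u v)"
  by (auto simp: isometry_group_def linear_bit_iff)

lemma isometry_group_id: "id \<in> isometry_group B"
  by (simp add: isometry_group_iff)

lemma isometry_group_comp:
  "g \<in> isometry_group B \<Longrightarrow> h \<in> isometry_group B \<Longrightarrow> g \<circ> h \<in> isometry_group B"
  by (auto simp: isometry_group_iff intro: bij_comp)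

lemma isometry_group_inv:
  assumes "g \<in> isometry_group B" shows "inv g \<in> isometry_group B"
proof -
  have g: "bij g" "\<And>x y. g (x + y) = g x + g y" "\<And>u v. B (g u) (g v) = B u v"
    using assms by (auto simp: isometry_group_iff)
  have gi: "g (inv g x) = x" for x using g(1) by (simp add: bij_is_surj surj_f_inv_f)
  have "inv g (x + y) = inv g x + inv g y" for x y
    by (rule injD[OF bij_is_inj[OF g(1)]]) (simp add: g gi)
  moreover have "B (inv g u) (inv g v) = B u v" for u v
    using g(3)[of "inv g u" "inv g v"] by (simp add: gi)
  ultimately show ?thesis using g(1) by (simp add: isometry_group_iff bij_imp_bij_inv)
qed

lemma form_act_comp:
  "bij g \<Longrightarrow> bij h \<Longrightarrow> form_act (g \<circ> h) \<phi> = form_act g (form_act h \<phi>)"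
  by (simp add: form_act_def o_inv_distrib)

lemma form_act_id [simp]: "form_act id \<phi> = \<phi>"
  by (simp add: form_act_def)

lemma form_act_inv_cancel [simp]:
  assumes "bij g"
  shows "form_act (inv g) (form_act g \<phi>) = \<phi>" "form_act g (form_act (inv g) \<phi>) = \<phi>"
  using assms by (simp_all add: form_act_def inv_inv_eq bij_is_inj bij_is_surj surj_f_inv_f)

lemma totally_singular_form_act:
  assumes "g \<in> isometry_group B" "totally_singular (form_act g \<phi>) U"
  shows "totally_singular \<phi> (inv g ` U)" "vec.dim (inv g ` U) = vec.dim U"
proof -
  have l: "Vector_Spaces.linear (*s) (*s) (inv g)" "inj (inv g)"
    using isometry_group_inv[OF assms(1)] by (auto simp: isometry_group_def bij_is_inj)
  show "vec.dim (inv g ` U) = vec.dim U"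
    using l by (intro vec.dim_image_eq) (auto intro: inj_on_subset)
  show "totally_singular \<phi> (inv g ` U)"
    using assms(2) l by (auto simp: totally_singular_def form_act_def intro: vec.linear_subspace_image)
qed

lemma witt_index_form_act:
  assumes g: "g \<in> isometry_group B"
  shows "witt_index (form_act g \<phi>) = witt_index \<phi>"
proof -
  have sub: "{vec.dim U | U. totally_singular (form_act h \<psi>) U} \<subseteq> {vec.dim U | U. totally_singular \<psi> U}"
    if "h \<in> isometry_group B" for h \<psi>
    using totally_singular_form_act[OF that] by (smt (verit) Collect_mono)
  have "{vec.dim U | U. totally_singular (form_act g \<phi>) U} = {vec.dim U | U. totally_singular \<phi> U}"
    using sub[OF g] sub[OF isometry_group_inv[OF g], of "form_act g \<phi>"] g
    by (simp add: isometry_group_iff subset_antisym)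
  then show ?thesis by (simp add: witt_index_def)
qed

lemma polarises_to_iff:
  "polarises_to \<phi> B \<longleftrightarrow> \<phi> 0 = 0 \<and> (\<forall>x y. \<phi> (x + y) = \<phi> x + \<phi> y + B x y)"
proof -
  have "(\<forall>c x. \<phi> (c *s x) = c\<^sup>2 * \<phi> x) \<longleftrightarrow> \<phi> 0 = 0"
  proof
    assume "\<forall>c x. \<phi> (c *s x) = c\<^sup>2 * \<phi> x"
    then have "\<phi> (0 *s 0) = 0\<^sup>2 * \<phi> 0" by blast
    then show "\<phi> 0 = 0" by simp
  next
    assume "\<phi> 0 = 0"
    then show "\<forall>c x. \<phi> (c *s x) = c\<^sup>2 * \<phi> x"
      by (metis bit.exhaust mult_1 mult_zero_left one_power2 vec.scale_one vec.scale_zero_left zero_power2)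
  qed
  \<comment> \<open>Characteristic 2 allows the polarisation identity to be solved for
    \<open>\<phi> (x + y)\<close> without signs.\<close>
  moreover have "a + c + d = e \<longleftrightarrow> a = c + d + e" for a c d e :: bit
    by (cases a; cases c; cases d; cases e) simp_all
  ultimately show ?thesis by (simp add: polarises_to_def)
qed

lemma quadratic_forms_form_act:
  assumes g: "g \<in> isometry_group B" and \<phi>: "\<phi> \<in> quadratic_forms B \<epsilon>"
  shows "form_act g \<phi> \<in> quadratic_forms B \<epsilon>"
proof -
  have "inv g 0 = 0" "inv g (x + y) = inv g x + inv g y" "B (inv g x) (inv g y) = B x y" for x y
    using isometry_group_inv[OF g] unfolding isometry_group_iff
    by (metis add_cancel_right_right)+
  then have "polarises_to (form_act g \<phi>) B"
    using \<phi> by (simp add: quadratic_forms_def polarises_to_iff form_act_def)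
  moreover have "has_type (form_act g \<phi>) \<epsilon>"
    using \<phi> by (cases \<epsilon>) (simp_all add: quadratic_forms_def witt_index_form_act[OF g])
  ultimately show ?thesis by (simp add: quadratic_forms_def)
qed

section \<open>Counting orbits on forms\<close>

text \<open>Composition with \<open>h\<close> carries the stabiliser of \<open>x\<close> onto the
  set of elements that send \<open>x\<close> to \<open>form_act h x\<close>, so all fibres over the
  orbit have the same size.\<close>

lemma card_orbit_times_card_stabiliser:
  fixes K :: "('v \<Rightarrow> 'v) set" and x :: "'v \<Rightarrow> 'k"
  assumes fin: "finite K" and bij: "\<And>g. g \<in> K \<Longrightarrow> bij g"
    and comp: "\<And>g h. g \<in> K \<Longrightarrow> h \<in> K \<Longrightarrow> g \<circ> h \<in> K" and inv: "\<And>g. g \<in> K \<Longrightarrow> inv g \<in> K"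
  shows "card K = card ((\<lambda>g. form_act g x) ` K) * card {g \<in> K. form_act g x = x}"
proof -
  let ?f = "\<lambda>g. form_act g x"
  have fibre: "card {g \<in> K. ?f g = ?f h} = card {g \<in> K. ?f g = x}" if h: "h \<in> K" for h
  proof (rule bij_betw_same_card[of "\<lambda>g. inv h \<circ> g"], rule bij_betw_byWitness[of _ "\<lambda>g. h \<circ> g"])
    show "\<forall>g\<in>{g \<in> K. ?f g = ?f h}. h \<circ> (inv h \<circ> g) = g"
      using bij[OF h] by (auto simp: fun_eq_iff bij_is_surj surj_f_inv_f)
    show "\<forall>g\<in>{g \<in> K. ?f g = x}. inv h \<circ> (h \<circ> g) = g"
      using bij[OF h] by (auto simp: fun_eq_iff bij_is_inj)
    show "(\<lambda>g. inv h \<circ> g) ` {g \<in> K. ?f g = ?f h} \<subseteq> {g \<in> K. ?f g = x}"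
      using h by (auto simp: comp inv bij form_act_comp)
    show "(\<lambda>g. h \<circ> g) ` {g \<in> K. ?f g = x} \<subseteq> {g \<in> K. ?f g = ?f h}"
      using h by (auto simp: comp bij form_act_comp)
  qed
  have "card K = (\<Sum>g\<in>K. 1)" by simp
  also have "\<dots> = (\<Sum>y\<in>?f ` K. \<Sum>g\<in>{g. g \<in> K \<and> ?f g = y}. 1)"
    by (rule sum.image_gen[OF fin])
  also have "\<dots> = (\<Sum>y\<in>?f ` K. card {g \<in> K. ?f g = x})"
    by (rule sum.cong) (auto simp: fibre)
  finally show ?thesis by simp
qed

text \<open>Stabilisers have order 1 or 2, so \<open>card K\<close> divides twice the length of each
  orbit, and \<open>S\<close> is a disjoint union of orbits.\<close>

lemma card_dvd_two_card_invariant: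
  fixes K :: "('v \<Rightarrow> 'v) set" and S :: "('v \<Rightarrow> 'k) set"
  assumes fin: "finite K" "finite S" and bij: "\<And>g. g \<in> K \<Longrightarrow> bij g"
    and comp: "\<And>g h. g \<in> K \<Longrightarrow> h \<in> K \<Longrightarrow> g \<circ> h \<in> K" and inv: "\<And>g. g \<in> K \<Longrightarrow> inv g \<in> K"
    and id: "id \<in> K"
    and S: "\<And>g x. g \<in> K \<Longrightarrow> x \<in> S \<Longrightarrow> form_act g x \<in> S"
    and stab: "\<And>x. x \<in> S \<Longrightarrow> card {g \<in> K. form_act g x = x} \<le> 2"
  shows "card K dvd 2 * card S"
proof -
  define orb where "orb x = (\<lambda>g. form_act g x) ` K" for x :: "'v \<Rightarrow> 'k"
  have self: "x \<in> orb x" for x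
    unfolding orb_def using id by (metis form_act_id image_eqI)
  have sub: "orb (form_act g x) \<subseteq> orb x" if "g \<in> K" for g x
    using that bij comp by (auto simp: orb_def simp flip: form_act_comp)
  have eq: "orb (form_act g x) = orb x" if "g \<in> K" for g x
    using sub[OF that, of x] sub[OF inv[OF that], of "form_act g x"] bij[OF that] by simp
  have dvd: "card K dvd 2 * card (orb x)" if "x \<in> S" for x
  proof -
    define s where "s = card {g \<in> K. form_act g x = x}"
    have "id \<in> {g \<in> K. form_act g x = x}" using id by simp
    then have "s > 0" using fin by (auto simp: s_def card_gt_0_iff)
    then have "s = 1 \<or> s = 2" using stab[OF that] by (auto simp: s_def)
    moreover have "card K = card (orb x) * s"
      unfolding s_def orb_def by (rule card_orbit_times_card_stabiliser) (use assms in auto)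
    ultimately show ?thesis by auto
  qed
  have S_eq: "S = \<Union>(orb ` S)" using self S by (auto simp: orb_def)
  have disj: "A \<inter> A' = {}" if "A \<in> orb ` S" "A' \<in> orb ` S" "A \<noteq> A'" for A A'
  proof (rule ccontr)
    assume "A \<inter> A' \<noteq> {}"
    then obtain z where "z \<in> A" "z \<in> A'" by auto
    moreover have "orb z = C" if C: "z \<in> C" "C \<in> orb ` S" for C
    proof -
      obtain y where "C = orb y" using C(2) by auto
      then show ?thesis using C(1) eq by (metis imageE orb_def)
    qed
    ultimately have "orb z = A" "orb z = A'" using that(1,2) by auto
    then show False using that by simp
  qed
  have "card S = (\<Sum>A\<in>orb ` S. card A)"
    by (subst S_eq, rule card_Union_disjoint)
       (use disj fin in \<open>auto simp: pairwise_def disjnt_def orb_def\<close>)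
  then have "2 * card S = (\<Sum>A\<in>orb ` S. 2 * card A)" by (simp add: sum_distrib_left)
  then show ?thesis using dvd by (auto intro: dvd_sum)
qed

section \<open>Shifts of forms and lifts to the extension field\<close>

context symplectic_trace_space
begin

text \<open>The forms polarising to \<open>B\<close> are a torsor under the space: two of them
  differ by an additive map, which is \<open>B\<close> against a unique vector
  \<open>w\<close>.\<close>

definition shift :: "(bit^'d \<Rightarrow> bit) \<Rightarrow> bit^'d \<Rightarrow> bit^'d \<Rightarrow> bit" where
  "shift \<phi> w x = \<phi> x + B x w"

lemma shift_0 [simp]: "shift \<phi> 0 = \<phi>"
  by (simp add: shift_def fun_eq_iff B_sym[of _ 0])

lemma shift_inject: "shift \<phi> v = shift \<phi> w \<longleftrightarrow> v = w"
proof
  assume "shift \<phi> v = shift \<phi> w"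
  then have "B x v = B x w" for x by (auto simp: shift_def fun_eq_iff)
  then have "B (v + w) x = 0" for x
    by (metis B_add_left B_sym bit_add_self)
  then show "v = w" using B_nondeg[of "v + w"] by (simp add: v_add_eq_0_iff)
qed simp

lemma shift_shift: "shift (shift \<phi> v) w = shift \<phi> (v + w)"
  by (simp add: shift_def fun_eq_iff B_add_right add.assoc)

lemma pol_0: "polarises_to \<phi> B \<Longrightarrow> \<phi> 0 = 0"
  and pol_add: "polarises_to \<phi> B \<Longrightarrow> \<phi> (x + y) = \<phi> x + \<phi> y + B x y"
  by (auto simp: polarises_to_iff)

lemma pol_shift: "polarises_to \<phi> B \<Longrightarrow> polarises_to (shift \<phi> w) B"
  by (simp add: polarises_to_iff shift_def B_add_left ac_simps)

lemma pol_shiftE: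
  assumes "polarises_to \<phi> B" "polarises_to \<psi> B"
  obtains w where "\<psi> = shift \<phi> w"
proof -
  have "\<phi> (x + y) + \<psi> (x + y) = (\<phi> x + \<psi> x) + (\<phi> y + \<psi> y)" for x y
    by (simp add: pol_add[OF assms(1)] pol_add[OF assms(2)] ac_simps)
  then obtain w where w: "\<And>x. \<phi> x + \<psi> x = B x w"
    using B.additive_represented[of "\<lambda>x. \<phi> x + \<psi> x"] by blast
  have "\<psi> = shift \<phi> w" by (simp add: shift_def fun_eq_iff w[symmetric])
  then show thesis by (rule that)
qed

text \<open>A form over the prime field whose polarisation is the trace of an extension form is itself
  the trace of a quadratic form over the extension field.\<close>

lemma ex1_lift:
  assumes "polarises_to \<phi> B"
  shows "\<exists>!t. \<forall>a. \<phi> (a \<odot> x) = tr (a\<^sup>2 * t)"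
proof -
  \<comment> \<open>The square root \<open>r\<close> is additive in characteristic 2; it turns the
    wanted coefficient of \<open>a\<^sup>2\<close> into a representing element for the trace
    pairing.\<close>
  define r where "r c = (THE a::'q. a\<^sup>2 = c)" for c
  have r: "(r c)\<^sup>2 = c" for c
  proof -
    obtain a where "a\<^sup>2 = c" by (rule ex_sqrt)
    then show ?thesis unfolding r_def by (rule theI) (use \<open>a\<^sup>2 = c\<close> in auto)
  qed
  have r_sq: "r (a\<^sup>2) = a" for a using r[of "a\<^sup>2"] by simp
  have r_add: "r (c + e) = r c + r e" for c e
    by (subst q_square_eq_iff[symmetric]) (simp only: r q_square_add)
  \<comment> \<open>The cross term vanishes because \<open>Bt x x = 0\<close>.\<close>
  have "\<phi> (r (c + e) \<odot> x) = \<phi> (r c \<odot> x) + \<phi> (r e \<odot> x)" for c e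
    by (simp add: r_add pol_add[OF assms] B_eq_tr Bt_scale_left Bt_scale_right)
  then obtain t where t: "\<And>c. \<phi> (r c \<odot> x) = tr (c * t)"
    using tr.additive_represented[of "\<lambda>c. \<phi> (r c \<odot> x)"] by blast
  have "\<forall>a. \<phi> (a \<odot> x) = tr (a\<^sup>2 * t)"
    using t[of "_\<^sup>2"] by (simp add: r_sq)
  moreover have "t' = t" if "\<forall>a. \<phi> (a \<odot> x) = tr (a\<^sup>2 * t')" for t'
  proof -
    have "tr ((t' + t) * c) = 0" for c
      using that t[of c] r[of c]
      by (metis bit_add_self distrib_right mult.commute tr_add)
    then show ?thesis using tr.nondeg[of "t' + t"] by (simp add: q_add_eq_0_iff)
  qed
  ultimately show ?thesis by blast
qed

text \<open>The condition runs over all multiples of \<open>x\<close>, since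
  \<open>\<phi> x = tr t\<close> alone leaves \<open>t\<close> undetermined.\<close>

definition lift :: "(bit^'d \<Rightarrow> bit) \<Rightarrow> bit^'d \<Rightarrow> 'q" where
  "lift \<phi> x = (THE t. \<forall>a. \<phi> (a \<odot> x) = tr (a\<^sup>2 * t))"

lemma tr_lift: "polarises_to \<phi> B \<Longrightarrow> \<phi> (a \<odot> x) = tr (a\<^sup>2 * lift \<phi> x)"
  unfolding lift_def using theI'[OF ex1_lift, of \<phi> x] by blast

lemma lift_eqI:
  "polarises_to \<phi> B \<Longrightarrow> (\<And>a. \<phi> (a \<odot> x) = tr (a\<^sup>2 * t)) \<Longrightarrow> lift \<phi> x = t"
  using ex1_lift[of \<phi> x] tr_lift[of \<phi> _ x] by blast

lemma form_eq_tr_lift: "polarises_to \<phi> B \<Longrightarrow> \<phi> x = tr (lift \<phi> x)"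
  using tr_lift[of \<phi> 1 x] by simp

lemma lift_scale: "polarises_to \<phi> B \<Longrightarrow> lift \<phi> (c \<odot> x) = c\<^sup>2 * lift \<phi> x"
  by (rule lift_eqI) (simp_all add: tr_lift power_mult_distrib mult.assoc)

lemma lift_add:
  "polarises_to \<phi> B \<Longrightarrow> lift \<phi> (x + y) = lift \<phi> x + lift \<phi> y + Bt x y"
  by (rule lift_eqI)
     (simp_all add: tr_lift pol_add B_eq_tr Bt_scale_left Bt_scale_right tr_add distrib_left
        power2_eq_square mult.assoc)

lemma lift_0 [simp]: "polarises_to \<phi> B \<Longrightarrow> lift \<phi> 0 = 0"
  by (rule lift_eqI) (simp_all add: pol_0)

text \<open>The square comes from \<open>tr (c\<^sup>2) = tr c\<close>: the functional
  \<open>B (a \<odot> x) w\<close> has to be written as a trace with coefficient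
  \<open>a\<^sup>2\<close>.\<close>

lemma lift_shift:
  assumes "polarises_to \<phi> B" shows "lift (shift \<phi> w) x = lift \<phi> x + (Bt x w)\<^sup>2"
proof (rule lift_eqI[OF pol_shift[OF assms]])
  have "B (a \<odot> x) w = tr (a\<^sup>2 * (Bt x w)\<^sup>2)" for a
    using tr_power2[of "a * Bt x w"] by (simp add: B_eq_tr Bt_scale_left power_mult_distrib)
  then show "shift \<phi> w (a \<odot> x) = tr (a\<^sup>2 * (lift \<phi> x + (Bt x w)\<^sup>2))" for a
    using assms by (simp add: shift_def tr_lift distrib_left tr_add)
qed

lemma form_act_shift:
  assumes "g \<in> isometry_group B"
  shows "form_act g (shift \<phi> w) = shift (form_act g \<phi>) (g w)"
proof -
  have "g (inv g x) = x" for x using assms by (simp add: isometry_group_iff bij_is_surj surj_f_inv_f)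
  then have "B (inv g x) w = B x (g w)" for x
    using assms by (metis isometry_group_iff)
  then show ?thesis by (simp add: form_act_def shift_def fun_eq_iff)
qed

text \<open>The last property is what makes colours invariant. It follows from uniqueness of the
  lift, because \<open>\<sigma>\<close> preserves traces.\<close>

lemma semisymplecticE:
  assumes "g \<in> semisymplectic_group smul Bt"
  obtains \<sigma> where "field_automorphism \<sigma>" "\<And>a x. g (a \<odot> x) = \<sigma> a \<odot> g x"
    "\<And>x y. Bt (g x) (g y) = \<sigma> (Bt x y)" "bij g" "\<And>x y. g (x + y) = g x + g y"
    "\<And>\<phi> x. polarises_to \<phi> B \<Longrightarrow> polarises_to (form_act g \<phi>) B \<Longrightarrow>
       lift (form_act g \<phi>) (g x) = \<sigma> (lift \<phi> x)"
proof -
  obtain \<sigma> where \<sigma>: "field_automorphism \<sigma>" "\<And>a x. g (a \<odot> x) = \<sigma> a \<odot> g x"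
    "\<And>x y. Bt (g x) (g y) = \<sigma> (Bt x y)" "bij g" "\<And>x y. g (x + y) = g x + g y"
    using assms by (auto simp: semisymplectic_group_def)
  note D = field_automorphismD[OF \<sigma>(1)]
  have "lift (form_act g \<phi>) (g x) = \<sigma> (lift \<phi> x)"
    if \<phi>: "polarises_to \<phi> B" "polarises_to (form_act g \<phi>) B" for \<phi> x
  proof (rule lift_eqI[OF \<phi>(2)])
    fix a
    obtain c where c: "a = \<sigma> c" using D(1) by (metis bij_pointE)
    have "form_act g \<phi> (a \<odot> g x) = \<phi> (c \<odot> x)"
      using \<sigma>(4) by (simp add: form_act_def c bij_is_inj flip: \<sigma>(2))
    also have "\<dots> = tr (c\<^sup>2 * lift \<phi> x)" by (rule tr_lift[OF \<phi>(1)])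
    also have "\<dots> = tr (\<sigma> (c\<^sup>2 * lift \<phi> x))" by (rule tr_automorphism[OF \<sigma>(1), symmetric])
    finally show "form_act g \<phi> (a \<odot> g x) = tr (a\<^sup>2 * \<sigma> (lift \<phi> x))"
      by (simp add: D c)
  qed
  with \<sigma> show thesis by (rule that)
qed

section \<open>Transvections and their action on forms\<close>

definition transvection :: "bit^'d \<Rightarrow> bit^'d \<Rightarrow> bit^'d" where
  "transvection v x = (if B x v = 0 then x else x + v)"

lemma transvection_transvection [simp]: "transvection v (transvection v x) = x"
  by (cases "B x v") (simp_all add: transvection_def B_add_left add.assoc)

lemma transvection_isometry: "transvection v \<in> isometry_group B"
proof -
  have "bij (transvection v)" by (rule involuntory_imp_bij) simp
  moreover have "transvection v (x + y) = transvection v x + transvection v y" for x y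
    by (cases "B x v"; cases "B y v") (simp_all add: transvection_def B_add_left ac_simps)
  moreover have "B (transvection v x) (transvection v y) = B x y" for x y
    by (cases "B x v"; cases "B y v")
       (simp_all add: transvection_def B_add_left B_add_right B_sym[of v y])
  ultimately show ?thesis by (simp add: isometry_group_iff)
qed

text \<open>Where \<open>B x v = 1\<close> the value of the form at \<open>x\<close> changes by
  \<open>\<phi> v + 1\<close>; elsewhere it does not change.\<close>

lemma form_act_transvection:
  assumes "polarises_to \<phi> B"
  shows "form_act (transvection v) \<phi> = (if \<phi> v = 0 then shift \<phi> v else \<phi>)"
proof -
  have "inv (transvection v) = transvection v"
    by (rule inv_equality) simp_all
  then show ?thesis
    using bit_not_zero_iff
    by (simp add: form_act_def fun_eq_iff transvection_def shift_def pol_add[OF assms])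
qed

text \<open>All multiples of \<open>v\<close> are fixed, which forces \<open>\<sigma>\<close> to be
  the identity. Linearity over the extension field would then make the set of displacements closed
  under scalars, but it is only \<open>{0, v}\<close>.\<close>

lemma transvection_not_semisymplectic:
  assumes "v \<noteq> 0" shows "transvection v \<notin> semisymplectic_group smul Bt"
proof
  assume "transvection v \<in> semisymplectic_group smul Bt"
  then obtain \<sigma> where \<sigma>: "field_automorphism \<sigma>"
    "\<And>a x. transvection v (a \<odot> x) = \<sigma> a \<odot> transvection v x"
    by (elim semisymplecticE) blast
  obtain y where y: "Bt v y \<noteq> 0" using Bt_nondeg assms by blast
  obtain \<theta> where \<theta>: "tr \<theta> = 1" by (rule ex_tr_1)
  have "v = a \<odot> v" if "a \<noteq> 0" for a
  proof -
    have 1: "\<sigma> a \<odot> v = a \<odot> v" if "B v v = 0" "B (a \<odot> v) v = 0"  for a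
      using \<sigma>(2)[of a v] by (simp add: transvection_def that)
    have \<sigma>a: "\<sigma> a = a" for a
    proof -
      have "B (a \<odot> v) v = 0" by (simp add: B_eq_tr Bt_scale_left)
      then have "\<sigma> a \<odot> v = a \<odot> v" using 1 by simp
      then have "(\<sigma> a + a) \<odot> v = 0" by simp
      then show ?thesis using assms by (metis scale_eq_0_iff q_add_eq_0_iff)
    qed
    \<comment> \<open>The scalar is chosen so that \<open>Bt (a \<odot> x) v = \<theta>\<close>,
      which has trace 1.\<close>
    define x where "x = (\<theta> / (a * Bt v y)) \<odot> y"
    have "B (a \<odot> x) v = 1"
      using y that \<theta> by (simp add: x_def B_eq_tr Bt_scale_left Bt_sym[of y])
    then have "a \<odot> x + v = transvection v (a \<odot> x)" by (simp add: transvection_def)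
    also have "\<dots> = a \<odot> transvection v x" by (simp add: \<sigma> \<sigma>a)
    finally have "a \<odot> x + v = a \<odot> x \<or> a \<odot> x + v = a \<odot> x + a \<odot> v"
      by (auto simp: transvection_def split: if_splits)
    then show ?thesis using assms by auto
  qed
  moreover obtain a :: 'q where "a \<noteq> 0" "a \<noteq> 1" by (rule q_not_only_01)
  ultimately have "(a + 1) \<odot> v = 0" by (metis v_add_self scale(2,4))
  then show False using assms \<open>a \<noteq> 1\<close> by (metis scale_eq_0_iff q_add_eq_0_iff)
qed

end

section \<open>Codewords with stabiliser in the semilinear group\<close>

lemma set_stabiliser_isometry_group:
  assumes G: "G = set_stabiliser (isometry_group B) \<Delta>"
  shows "g \<in> G \<Longrightarrow> g \<in> isometry_group B" "g \<in> G \<Longrightarrow> bij g" "id \<in> G"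
    "g \<in> G \<Longrightarrow> h \<in> G \<Longrightarrow> g \<circ> h \<in> G" "g \<in> G \<Longrightarrow> inv g \<in> G"
    "g \<in> G \<Longrightarrow> \<phi> \<in> \<Delta> \<Longrightarrow> form_act g \<phi> \<in> \<Delta>"
proof -
  show *: "g \<in> isometry_group B" "bij g" if "g \<in> G" for g
    using that by (auto simp: G set_stabiliser_def isometry_group_iff)
  show "id \<in> G"
    by (auto simp: G set_stabiliser_def isometry_group_id image_iff)
  show "g \<circ> h \<in> G" if "g \<in> G" "h \<in> G"
  proof -
    have "form_act (g \<circ> h) ` \<Delta> = form_act g ` form_act h ` \<Delta>"
      using *(2) that by (auto simp: form_act_comp image_iff)
    then show ?thesis
      using that by (simp add: G set_stabiliser_def isometry_group_comp)
  qed
  show "inv g \<in> G" if "g \<in> G"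
  proof -
    have "form_act (inv g) ` form_act g ` \<Delta> = \<Delta>"
      using *(2)[OF that] by (simp add: image_image)
    then show ?thesis
      using that by (simp add: G set_stabiliser_def isometry_group_inv)
  qed
  show "form_act g \<phi> \<in> \<Delta>" if "g \<in> G" "\<phi> \<in> \<Delta>"
    using that by (auto simp: G set_stabiliser_def)
qed

text \<open>For \<open>e \<le> d\<close> the positive number \<open>2 * (e - 1)\<close> is a
  multiple of \<open>d\<close> below \<open>2 * d\<close>, so it equals \<open>d\<close>. Then
  \<open>2 * (d - 1) = 4 * e - 6\<close>, so \<open>e\<close> divides 6.\<close>

lemma mutual_dvd_imp_sum_le_16:
  fixes d e :: nat
  assumes "2 \<le> d" "2 \<le> e" "e dvd 2 * (d - 1)" "d dvd 2 * (e - 1)"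
  shows "d + e \<le> 16"
proof -
  have *: "d + e \<le> 16" if de: "2 \<le> e" "e \<le> d" "e dvd 2 * (d - 1)" "d dvd 2 * (e - 1)" for d e :: nat
  proof -
    obtain k where k: "2 * (e - 1) = d * k" using de(4) by auto
    have "k \<noteq> 0" using k de(1) by (cases k) auto
    moreover have "k < 2"
    proof (rule ccontr)
      assume "\<not> k < 2"
      then have "d * 2 \<le> d * k" by simp
      then show False using k de by linarith
    qed
    ultimately have "k = 1" by simp
    then have d: "d = 2 * (e - 1)" using k by simp
    have "2 * (d - 1) + 6 = 4 * e" using d de(1) by simp
    then have "e dvd 6" using de(3) by (metis dvd_add_right_iff dvd_triv_right)
    then have "e \<le> 6" by (simp add: dvd_imp_le)
    then show ?thesis using d by simp
  qed
  show ?thesis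
    using *[of e d] *[of d e] assms by (cases "e \<le> d") (simp_all add: add.commute)
qed

text \<open>Of the code, one codeword and its stabiliser are kept. The conditions treat
  \<open>\<Delta>\<close> and \<open>Q - \<Delta>\<close> alike.\<close>

locale semilinear_codeword = symplectic_trace_space smul Bt B b
  for smul :: "'q::{field,finite} \<Rightarrow> bit^'d \<Rightarrow> bit^'d" (infixr "\<odot>" 75)
    and Bt :: "bit^'d \<Rightarrow> bit^'d \<Rightarrow> 'q" and B :: "bit^'d \<Rightarrow> bit^'d \<Rightarrow> bit" and b :: nat +
  fixes Q \<Delta> :: "(bit^'d \<Rightarrow> bit) set"
  assumes Q_pol: "\<phi> \<in> Q \<Longrightarrow> polarises_to \<phi> B"
    and Q_inv: "g \<in> isometry_group B \<Longrightarrow> \<phi> \<in> Q \<Longrightarrow> form_act g \<phi> \<in> Q"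
    and \<Delta>_sub: "\<Delta> \<subseteq> Q"
    and card_\<Delta>: "2 \<le> card \<Delta>"
    and card_compl: "2 \<le> card (Q - \<Delta>)"
    and flag_transitive: "\<phi> \<in> \<Delta> \<Longrightarrow> \<psi> \<in> Q - \<Delta> \<Longrightarrow> \<phi>' \<in> \<Delta> \<Longrightarrow> \<psi>' \<in> Q - \<Delta> \<Longrightarrow>
      \<exists>g\<in>set_stabiliser (isometry_group B) \<Delta>. form_act g \<phi> = \<phi>' \<and> form_act g \<psi> = \<psi>'"
    and stabiliser_semilinear:
      "set_stabiliser (isometry_group B) \<Delta> \<subseteq> semisymplectic_group smul Bt"
begin

abbreviation "G \<equiv> set_stabiliser (isometry_group B) \<Delta>"

lemmas G_group = set_stabiliser_isometry_group[where B = B and \<Delta> = \<Delta>, OF refl]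

lemma complement_memberE: obtains \<psi> where "\<psi> \<in> Q - \<Delta>"
proof -
  have "Q - \<Delta> \<noteq> {}" using card_compl by (metis card.empty not_numeral_le_zero)
  then show thesis using that by blast
qed

text \<open>Isometries permute \<open>Q\<close>, so a set of forms and its complement have the same
  stabiliser. This transfers every result on \<open>\<Delta>\<close> to
  \<open>Q - \<Delta>\<close>.\<close>

lemma complement: "semilinear_codeword smul Bt B b Q (Q - \<Delta>)"
proof -
  have "form_act g ` (Q - \<Delta>) = Q - \<Delta> \<longleftrightarrow> form_act g ` \<Delta> = \<Delta>" if g: "g \<in> isometry_group B" for g
  proof -
    have bij: "bij g" using g by (simp add: isometry_group_iff)
    then have inj: "inj (form_act g)" by (metis form_act_inv_cancel(1) injI)
    have "Q \<subseteq> form_act g ` Q"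
      using Q_inv[OF isometry_group_inv[OF g]] bij by (metis form_act_inv_cancel(2) image_eqI subsetI)
    then have Q: "form_act g ` Q = Q" using Q_inv[OF g] by auto
    have "form_act g ` (Q - \<Delta>) = Q - form_act g ` \<Delta>"
      using Q by (simp add: image_set_diff[OF inj])
    moreover have "form_act g ` \<Delta> \<subseteq> Q" using \<Delta>_sub Q by auto
    ultimately show ?thesis using \<Delta>_sub by (metis double_diff subset_refl)
  qed
  then have G: "set_stabiliser (isometry_group B) (Q - \<Delta>) = G"
    unfolding set_stabiliser_def by blast
  have D: "Q - (Q - \<Delta>) = \<Delta>" using \<Delta>_sub by auto
  show ?thesis
  proof (unfold_locales, unfold G D)
    show "\<exists>g\<in>G. form_act g \<phi> = \<phi>' \<and> form_act g \<psi> = \<psi>'"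
      if "\<phi> \<in> Q - \<Delta>" "\<psi> \<in> \<Delta>" "\<phi>' \<in> Q - \<Delta>" "\<psi>' \<in> \<Delta>" for \<phi> \<psi> \<phi>' \<psi>'
      using flag_transitive[OF that(2,1,4,3)] by blast
  qed (simp_all add: Q_pol Q_inv card_\<Delta> card_compl stabiliser_semilinear)
qed

text \<open>The transvection in \<open>v\<close> maps \<open>\<phi>\<close> to this shift. This is
  the supply of further forms in \<open>Q\<close> of the given type.\<close>

lemma shift_in_Q: "\<phi> \<in> Q \<Longrightarrow> \<phi> v = 0 \<Longrightarrow> shift \<phi> v \<in> Q"
  using Q_inv[OF transvection_isometry[of v], of \<phi>] form_act_transvection[OF Q_pol, of \<phi> v] by simp

text \<open>A transvection is an involution, so if it mapped \<open>\<Delta>\<close> into itself it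
  would lie in the stabiliser and be semilinear.\<close>

lemma transvection_moves_codeword:
  assumes "v \<noteq> 0" obtains \<phi> where "\<phi> \<in> \<Delta>" "form_act (transvection v) \<phi> \<notin> \<Delta>"
proof -
  have "\<exists>\<phi>\<in>\<Delta>. form_act (transvection v) \<phi> \<notin> \<Delta>"
  proof (rule ccontr)
    assume "\<not> ?thesis"
    then have *: "form_act (transvection v) \<phi> \<in> \<Delta>" if "\<phi> \<in> \<Delta>" for \<phi> using that by blast
    have b: "bij (transvection v)" using transvection_isometry[of v] by (simp add: isometry_group_iff)
    have "transvection v \<circ> transvection v = id" by (simp add: fun_eq_iff)
    then have "form_act (transvection v) (form_act (transvection v) \<phi>) = \<phi>" for \<phi>
      using form_act_comp[OF b b, of \<phi>] by simp
    then have "form_act (transvection v) ` \<Delta> = \<Delta>"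
      using * by (metis (no_types, lifting) image_eqI image_subsetI subsetI subset_antisym)
    then have "transvection v \<in> G"
      by (simp add: set_stabiliser_def transvection_isometry)
    then show False using transvection_not_semisymplectic[OF assms] stabiliser_semilinear by auto
  qed
  then show thesis using that by blast
qed

section \<open>Colours of pairs between codeword and complement\<close>

lemma cross_colour:
  assumes "\<phi> \<in> \<Delta>" "shift \<phi> w \<in> Q - \<Delta>" "\<phi>' \<in> \<Delta>" "shift \<phi>' w' \<in> Q - \<Delta>"
  obtains \<sigma> where "field_automorphism \<sigma>" "lift \<phi>' w' = \<sigma> (lift \<phi> w)"
proof -
  obtain g where g: "g \<in> G" "form_act g \<phi> = \<phi>'" "form_act g (shift \<phi> w) = shift \<phi>' w'"
    using flag_transitive[OF assms] by blast
  \<comment> \<open>Shift vectors move along with the forms, so \<open>g\<close> carries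
    \<open>w\<close> to \<open>w'\<close>.\<close>
  have "shift \<phi>' (g w) = shift \<phi>' w'"
    using form_act_shift[OF G_group(1)[OF g(1)]] g by metis
  then have w': "w' = g w" by (simp add: shift_inject)
  obtain \<sigma> where \<sigma>: "field_automorphism \<sigma>"
    "\<And>\<phi> x. polarises_to \<phi> B \<Longrightarrow> polarises_to (form_act g \<phi>) B \<Longrightarrow>
       lift (form_act g \<phi>) (g x) = \<sigma> (lift \<phi> x)"
    using g(1) stabiliser_semilinear by (meson semisymplecticE subsetD)
  have "lift \<phi>' w' = \<sigma> (lift \<phi> w)"
    using \<sigma>(2)[of \<phi> w] Q_pol assms \<Delta>_sub g w' by auto
  then show thesis using \<sigma>(1) that by blast
qed

text \<open>The trace of the colour is the same for all cross pairs, and a transvection moving some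
  form out of \<open>\<Delta>\<close> supplies a cross pair of trace 0.\<close>

lemma cross_singular:
  assumes "\<phi> \<in> \<Delta>" "shift \<phi> w \<in> Q - \<Delta>" shows "\<phi> w = 0"
proof (rule ccontr)
  assume \<phi>w: "\<phi> w \<noteq> 0"
  have *: "\<psi> v \<noteq> 0" if \<psi>v: "\<psi> \<in> \<Delta>" "shift \<psi> v \<in> Q - \<Delta>" for \<psi> v
  proof -
    obtain \<sigma> where "field_automorphism \<sigma>" "lift \<psi> v = \<sigma> (lift \<phi> w)"
      using cross_colour[OF assms \<psi>v] .
    then have "\<psi> v = \<phi> w"
      using \<psi>v assms \<Delta>_sub Q_pol by (metis form_eq_tr_lift subsetD tr_automorphism)
    then show ?thesis using \<phi>w by simp
  qed
  have "(1::bit^'d) \<noteq> 0" by (simp add: vec_eq_iff)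
  then obtain \<psi> where \<psi>: "\<psi> \<in> \<Delta>" "form_act (transvection 1) \<psi> \<notin> \<Delta>"
    by (rule transvection_moves_codeword)
  then have "\<psi> 1 = 0" "shift \<psi> 1 \<notin> \<Delta>"
    using form_act_transvection[of \<psi> 1] Q_pol \<Delta>_sub by (auto split: if_splits)
  then show False using *[OF \<psi>(1), of 1] shift_in_Q[of \<psi> 1] \<psi>(1) \<Delta>_sub by auto
qed

text \<open>The colour of the third side in the triangle of forms \<open>\<phi>\<close>,
  \<open>shift \<phi> v\<close>, \<open>shift \<phi> w\<close>; its shift vector is
  \<open>v + w\<close> by \<open>shift_diff\<close>.\<close>

lemma lift_shift_diff:
  assumes "\<phi> \<in> Q"
  shows "lift (shift \<phi> v) (v + w) = lift \<phi> v + lift \<phi> w + Bt v w + (Bt v w)\<^sup>2"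
  using Q_pol[OF assms]
  by (simp add: lift_shift lift_add Bt_add_left Bt_sym[of w v])

lemma shift_diff: "shift (shift \<phi> v) (v + w) = shift \<phi> w"
  by (simp add: shift_shift)

section \<open>Excluding the colour 0 and singular vectors\<close>

lemma ex_Bt_eq_1:
  assumes "w \<noteq> 0" obtains y where "Bt w y = 1"
proof -
  obtain y where "Bt w y \<noteq> 0" using Bt_nondeg assms by blast
  then have "Bt w ((1 / Bt w y) \<odot> y) = 1" by (simp add: Bt_scale_right)
  then show thesis by (rule that)
qed

text \<open>If cross pairs had colour 0, a side \<open>v\<close> of colour
  \<open>d \<noteq> 0\<close> with \<open>tr d = 0\<close> would stay inside
  \<open>\<Delta>\<close>. With \<open>Bt v w = 1\<close> the third side has colour \<open>d\<close>
  again, yet it crosses.\<close>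

lemma cross_nonsingular:
  assumes "\<phi> \<in> \<Delta>" "shift \<phi> w \<in> Q - \<Delta>" shows "lift \<phi> w \<noteq> 0"
proof
  assume 0: "lift \<phi> w = 0"
  have *: "lift \<psi> v = 0" if "\<psi> \<in> \<Delta>" "shift \<psi> v \<in> Q - \<Delta>" for \<psi> v
    using cross_colour[OF assms that] 0 field_automorphismD(3) by metis
  have \<phi>: "\<phi> \<in> Q" "polarises_to \<phi> B" using assms(1) \<Delta>_sub Q_pol by auto
  have "w \<noteq> 0" using assms by auto
  then obtain y where y: "Bt w y = 1" by (rule ex_Bt_eq_1)
  obtain d where d: "tr d = 0" "d \<noteq> 0" by (rule ex_tr_0)
  \<comment> \<open>Adding a multiple \<open>l \<odot> w\<close> of the singular vector
    \<open>w\<close> changes the lift at \<open>y\<close> by exactly \<open>l\<close>, because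
    \<open>Bt y w = 1\<close>.\<close>
  define v where "v = y + (lift \<phi> y + d) \<odot> w"
  have v: "lift \<phi> v = d"
    unfolding v_def lift_add[OF \<phi>(2)] lift_scale[OF \<phi>(2)]
    using 0 y by (simp add: Bt_scale_right Bt_sym[of y w] ac_simps del: scale(2))
  have vw: "Bt v w = 1"
    using y by (simp add: v_def Bt_add_left Bt_scale_left Bt_sym[of y] del: scale)
  have "\<phi> v = 0" using v d \<phi> by (simp add: form_eq_tr_lift)
  then have "shift \<phi> v \<in> Q" using shift_in_Q \<phi> by blast
  then have v\<Delta>: "shift \<phi> v \<in> \<Delta>" using *[OF assms(1)] v d by auto
  have "lift (shift \<phi> v) (v + w) = 0"
    by (rule *[OF v\<Delta>]) (subst shift_diff, rule assms(2))
  then show False using d by (simp add: lift_shift_diff[OF \<phi>(1)] v 0 vw)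
qed

text \<open>A singular vector yields a singular \<open>v\<close> with \<open>Bt v w = \<mu>\<close>,
  where \<open>\<mu>\<^sup>2 + \<mu>\<close> is the colour \<open>c\<close> of a cross pair. The
  side \<open>v\<close> of colour 0 stays in \<open>\<Delta>\<close>, and the third side is a cross
  pair of colour \<open>c + \<mu> + \<mu>\<^sup>2 = 0\<close>.\<close>

lemma anisotropic_codeword:
  assumes "\<phi> \<in> \<Delta>" "x \<noteq> 0" shows "lift \<phi> x \<noteq> 0"
proof
  assume x: "lift \<phi> x = 0"
  have \<phi>: "\<phi> \<in> Q" "polarises_to \<phi> B" using assms(1) \<Delta>_sub Q_pol by auto
  obtain \<psi> where "\<psi> \<in> Q - \<Delta>" by (rule complement_memberE)
  then obtain w where w: "shift \<phi> w \<in> Q - \<Delta>" using pol_shiftE[OF \<phi>(2)] Q_pol by (metis DiffD1)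
  define c where "c = lift \<phi> w"
  have c: "c \<noteq> 0" "tr c = 0"
    using cross_nonsingular[OF assms(1) w] cross_singular[OF assms(1) w] \<phi>
    by (simp_all add: c_def form_eq_tr_lift)
  then have "w \<noteq> 0" using \<phi> by (auto simp: c_def)
  obtain \<mu> where \<mu>: "\<mu>\<^sup>2 + \<mu> = c" using c by (rule_tac artin_schreier)
  \<comment> \<open>A group is not the union of two proper subgroups, here the kernels of
    \<open>Bt x\<close> and \<open>Bt w\<close>.\<close>
  obtain y where y: "Bt x y \<noteq> 0" "Bt w y \<noteq> 0"
  proof -
    obtain y1 y2 where "Bt x y1 = 1" "Bt w y2 = 1"
      using ex_Bt_eq_1 assms(2) \<open>w \<noteq> 0\<close> by metis
    then have "Bt x y1 \<noteq> 0 \<and> Bt w y1 \<noteq> 0 \<or> Bt x y2 \<noteq> 0 \<and> Bt w y2 \<noteq> 0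
        \<or> Bt x (y1 + y2) \<noteq> 0 \<and> Bt w (y1 + y2) \<noteq> 0"
      by (auto simp: Bt_add_right)
    then show thesis using that by blast
  qed
  \<comment> \<open>Either \<open>x\<close> itself serves, or \<open>y\<close> is made singular by
    adding a multiple of \<open>x\<close>, which leaves its product with \<open>w\<close>
    unchanged.\<close>
  obtain z where z: "lift \<phi> z = 0" "Bt z w \<noteq> 0"
  proof (cases "Bt x w = 0")
    case True
    define z where "z = y + (lift \<phi> y / Bt x y) \<odot> x"
    have "lift \<phi> z = 0"
      unfolding z_def lift_add[OF \<phi>(2)] lift_scale[OF \<phi>(2)]
      using x y by (simp add: Bt_scale_right Bt_sym[of y])
    moreover have "Bt z w \<noteq> 0"
      using y True by (simp add: z_def Bt_add_left Bt_scale_left Bt_sym[of y])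
    ultimately show thesis by (rule that)
  next
    case False
    then show thesis using that x by blast
  qed
  define v where "v = (\<mu> / Bt z w) \<odot> z"
  have v: "lift \<phi> v = 0" "Bt v w = \<mu>"
    using z \<phi> by (simp_all add: v_def lift_scale Bt_scale_left)
  then have "\<phi> v = 0" using \<phi> by (simp add: form_eq_tr_lift)
  then have "shift \<phi> v \<in> Q" using shift_in_Q \<phi> by blast
  then have v\<Delta>: "shift \<phi> v \<in> \<Delta>" using cross_nonsingular[OF assms(1)] v by auto
  have "lift (shift \<phi> v) (v + w) \<noteq> 0"
    by (rule cross_nonsingular[OF v\<Delta>]) (subst shift_diff, rule w)
  moreover have "lift (shift \<phi> v) (v + w) = c + (\<mu>\<^sup>2 + \<mu>)"
    by (simp add: lift_shift_diff[OF \<phi>(1)] v c_def ac_simps)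
  ultimately show False using \<mu> by simp
qed

lemma anisotropic: "\<phi> \<in> Q \<Longrightarrow> x \<noteq> 0 \<Longrightarrow> lift \<phi> x \<noteq> 0"
  using anisotropic_codeword semilinear_codeword.anisotropic_codeword[OF complement] by blast

text \<open>A pair inside \<open>\<Delta>\<close> completes to a triangle with a form outside. Both
  other sides cross and have trace 0, and the traces of the three sides add up to 0.\<close>

lemma codeword_pair_singular:
  assumes "\<phi> \<in> \<Delta>" "shift \<phi> v \<in> Q" shows "\<phi> v = 0"
proof (cases "shift \<phi> v \<in> \<Delta>")
  case True
  have \<phi>: "\<phi> \<in> Q" "polarises_to \<phi> B" using assms(1) \<Delta>_sub Q_pol by auto
  obtain \<psi> where "\<psi> \<in> Q - \<Delta>" by (rule complement_memberE)
  then obtain w where w: "shift \<phi> w \<in> Q - \<Delta>" using pol_shiftE[OF \<phi>(2)] Q_pol by (metis DiffD1)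
  have "\<phi> w = 0" using cross_singular assms(1) w by blast
  moreover have "shift \<phi> v (v + w) = 0"
    by (rule cross_singular[OF True]) (subst shift_diff, rule w)
  ultimately show ?thesis
    by (simp add: shift_def pol_add[OF \<phi>(2)] B_add_left B_sym[of w v])
next
  case False
  then show ?thesis using cross_singular assms by blast
qed

lemma pair_singular: "\<phi> \<in> Q \<Longrightarrow> shift \<phi> v \<in> Q \<Longrightarrow> \<phi> v = 0"
  using codeword_pair_singular semilinear_codeword.codeword_pair_singular[OF complement] by blast

section \<open>The space as a plane over the extension field\<close>

text \<open>On vectors orthogonal to \<open>w\<close> the lift has no cross term with
  \<open>w\<close>, so a suitable multiple of \<open>w\<close> cancels its value at
  \<open>x\<close>; by anisotropy the sum is 0.\<close>

lemma perpE:
  assumes "\<phi> \<in> Q" "w \<noteq> 0" "Bt x w = 0" obtains l where "x = l \<odot> w"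
proof -
  have \<phi>: "polarises_to \<phi> B" using assms Q_pol by auto
  have w: "lift \<phi> w \<noteq> 0" using anisotropic assms by blast
  obtain l where l: "l\<^sup>2 = lift \<phi> x / lift \<phi> w" by (rule ex_sqrt)
  have "lift \<phi> (x + l \<odot> w) = 0"
    unfolding lift_add[OF \<phi>] lift_scale[OF \<phi>] l using w assms(3) by (simp add: Bt_scale_right)
  then have "x + l \<odot> w = 0" using anisotropic[OF assms(1)] by blast
  then show thesis using that by (simp add: v_add_eq_0_iff)
qed

lemma codeword_pairE: obtains \<phi> v where "\<phi> \<in> \<Delta>" "shift \<phi> v \<in> \<Delta>" "v \<noteq> 0"
proof -
  have "\<not> card \<Delta> \<le> Suc 0" using card_\<Delta> by simp
  then obtain \<phi> \<psi> where "\<phi> \<in> \<Delta>" "\<psi> \<in> \<Delta>" "\<phi> \<noteq> \<psi>"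
    using card_le_Suc0_iff_eq[of \<Delta>] by auto
  then show thesis using that pol_shiftE[of \<phi> \<psi>] Q_pol \<Delta>_sub by (metis shift_0 subsetD)
qed

text \<open>Over the field of order 4 the group of isometries acts on the six anisotropic forms as the
  symmetric group, with the transvections acting as transpositions.\<close>

lemma b_neq_2: "b \<noteq> 2"
proof
  assume b: "b = 2"
  \<comment> \<open>For \<open>b = 2\<close> the trace of \<open>c\<close> is
    \<open>c + c\<^sup>2\<close>, so trace 0 puts \<open>c\<close> into the prime field.\<close>
  have idem: "c\<^sup>2 = c" if "tr c = 0" for c
    using that absolute_trace_eq[of c]
    by (simp add: b absolute_trace_def numeral_2_eq_2 lessThan_Suc q_add_eq_0_iff)
  then have tr_1: "c = 1" if "tr c = 0" "c \<noteq> 0" for c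
    using that idem[of c] by (simp add: power2_eq_square)
  obtain \<phi> v where v: "\<phi> \<in> \<Delta>" "shift \<phi> v \<in> \<Delta>" "v \<noteq> 0" by (rule codeword_pairE)
  have \<phi>: "\<phi> \<in> Q" "polarises_to \<phi> B" using v(1) \<Delta>_sub Q_pol by auto
  have lift1: "lift \<phi> w = 1" if "shift \<phi> w \<in> Q" "w \<noteq> 0" for w
    using pair_singular[OF \<phi>(1) that(1)] anisotropic[OF \<phi>(1) that(2)] \<phi>(2)
    by (intro tr_1) (simp_all add: form_eq_tr_lift)
  obtain \<psi> where \<psi>: "\<psi> \<in> \<Delta>" "form_act (transvection v) \<psi> \<notin> \<Delta>"
    using v(3) by (rule transvection_moves_codeword)
  have \<psi>Q: "\<psi> \<in> Q" "polarises_to \<psi> B" using \<psi>(1) \<Delta>_sub Q_pol by auto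
  have \<psi>v: "\<psi> v = 0" "shift \<psi> v \<notin> \<Delta>"
    using form_act_transvection[OF \<psi>Q(2), of v] \<psi> by (auto split: if_splits)
  \<comment> \<open>The transvection swaps \<open>\<phi>\<close> and \<open>shift \<phi> v\<close>,
    both in \<open>\<Delta>\<close>, so \<open>\<psi>\<close> is a third form. Two sides of the
    triangle have colour 1 and \<open>Bt v w\<close> lies in the prime field, so the third side has
    colour 0, against anisotropy.\<close>
  obtain w where w: "\<psi> = shift \<phi> w" using pol_shiftE[OF \<phi>(2) \<psi>Q(2)] .
  have "\<phi> v = 0" using pair_singular \<phi> v \<Delta>_sub by blast
  then have "tr (Bt v w) = 0" using \<psi>v(1) by (simp add: w shift_def B_eq_tr)
  then have "(Bt v w)\<^sup>2 = Bt v w" by (rule idem)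
  moreover have "w \<noteq> 0" using \<psi>v(2) v(2) by (auto simp: w)
  moreover have "w \<noteq> v" using \<psi>v(2) v(1) by (auto simp: w shift_shift)
  moreover have "lift \<phi> v = 1" using lift1 v \<Delta>_sub by blast
  moreover have "lift (shift \<phi> v) (v + w)
      = (lift \<phi> v + lift \<phi> w) + (Bt v w + (Bt v w)\<^sup>2)"
    by (simp only: lift_shift_diff[OF \<phi>(1)] add.assoc)
  ultimately have "lift (shift \<phi> v) (v + w) = 0"
    using lift1[of w] \<psi>Q(1) w q_add_self by simp
  moreover have "v + w \<noteq> 0" using \<open>w \<noteq> v\<close> by (auto simp: v_add_eq_0_iff)
  ultimately show False using anisotropic v(2) \<Delta>_sub by blast
qed

section \<open>Stabiliser orders and the final count\<close>

text \<open>Fixing both forms fixes \<open>w\<close> and its colour \<open>c\<close>. As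
  \<open>c\<close> is neither 0 nor 1, the automorphism is trivial, and a linear map of the plane
  fixing \<open>w\<close> is determined by its value at \<open>y\<close>, for which two choices
  remain.\<close>

lemma pair_stabiliser_le_2:
  assumes "\<phi> \<in> Q" "\<psi> \<in> Q" "\<phi> \<noteq> \<psi>"
  shows "card {g \<in> G. form_act g \<phi> = \<phi> \<and> form_act g \<psi> = \<psi>} \<le> 2"
proof -
  let ?S = "{g \<in> G. form_act g \<phi> = \<phi> \<and> form_act g \<psi> = \<psi>}"
  have \<phi>: "polarises_to \<phi> B" using assms(1) Q_pol by auto
  obtain w where w: "\<psi> = shift \<phi> w" using pol_shiftE[OF \<phi>] Q_pol assms(2) by metis
  have "w \<noteq> 0" using assms(3) w by auto
  define c where "c = lift \<phi> w"
  have c: "c \<noteq> 0" "tr c = 0"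
    using pair_singular[OF assms(1)] anisotropic[OF assms(1) \<open>w \<noteq> 0\<close>] assms(2) w \<phi>
    by (auto simp: c_def simp flip: form_eq_tr_lift)
  \<comment> \<open>For odd \<open>b\<close> the element 1 has trace 1, whereas \<open>c\<close> has
    trace 0.\<close>
  have "odd b" using prime_b b_neq_2 by (metis b_ge_2 le_neq_implies_less prime_odd_nat)
  then have "tr 1 = 1"
  proof -
    have "absolute_trace b (1::'q) = of_nat b" by (simp add: absolute_trace_def)
    also have "\<dots> = 1"
      using \<open>odd b\<close> by (elim oddE) simp
    finally show ?thesis by (simp add: tr_def)
  qed
  then have c1: "c \<noteq> 1" using c(2) by auto
  obtain y where y: "Bt w y = 1" using \<open>w \<noteq> 0\<close> by (rule ex_Bt_eq_1)
  have S: "g w = w" "g y \<in> {y, y + (1 / c) \<odot> w}" "\<And>a x. g (a \<odot> x) = a \<odot> g x"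
    "\<And>x z. g (x + z) = g x + g z" if "g \<in> ?S" for g
  proof -
    have g: "g \<in> G" "form_act g \<phi> = \<phi>" "form_act g \<psi> = \<psi>" using that by auto
    have "shift \<phi> (g w) = shift \<phi> w"
      using form_act_shift[OF G_group(1)[OF g(1)]] g w by metis
    then show gw: "g w = w" by (simp add: shift_inject)
    have "g \<in> semisymplectic_group smul Bt" using g(1) stabiliser_semilinear by blast
    then obtain \<sigma> where \<sigma>: "field_automorphism \<sigma>" "\<And>a x. g (a \<odot> x) = \<sigma> a \<odot> g x"
      "\<And>x y. Bt (g x) (g y) = \<sigma> (Bt x y)" "\<And>x y. g (x + y) = g x + g y"
      "\<And>\<phi> x. polarises_to \<phi> B \<Longrightarrow> polarises_to (form_act g \<phi>) B \<Longrightarrow>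
         lift (form_act g \<phi>) (g x) = \<sigma> (lift \<phi> x)"
      by (elim semisymplecticE) blast
    have "\<sigma> c = c" using \<sigma>(5)[OF \<phi>, of w] \<phi> g gw by (simp add: c_def)
    then have \<sigma>id: "\<sigma> = id" using field_automorphism_trivial[OF \<sigma>(1) prime_b card_q] c c1 by blast
    show "g (a \<odot> x) = a \<odot> g x" for a x using \<sigma> \<sigma>id by simp
    show "g (x + z) = g x + g z" for x z by (rule \<sigma>(4))
    have "Bt (g y) w = Bt y w" using \<sigma>(3)[of y w] gw \<sigma>id by simp
    then have "Bt (y + g y) w = 0" by (simp add: Bt_add_left)
    then obtain l where "y + g y = l \<odot> w" by (rule perpE[OF assms(1) \<open>w \<noteq> 0\<close>])
    then have l: "g y = y + l \<odot> w" by (metis v_add_left_cancel)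
    \<comment> \<open>Preservation of the lift at \<open>y\<close> turns into the quadratic equation
      \<open>l\<^sup>2 * c + l = 0\<close>.\<close>
    have "lift \<phi> (g y) = lift \<phi> y" using \<sigma>(5)[OF \<phi>, of y] \<phi> g \<sigma>id by simp
    moreover have "lift \<phi> (g y) = lift \<phi> y + (l\<^sup>2 * c + l)"
      unfolding l lift_add[OF \<phi>] lift_scale[OF \<phi>] using y
      by (simp add: Bt_scale_right Bt_sym[of y] c_def add.assoc)
    ultimately have "l\<^sup>2 * c + l = 0" by simp
    then have "l * (l * c) = l * 1" by (simp add: q_add_eq_0_iff power2_eq_square mult.assoc)
    then have "l = 0 \<or> l = 1 / c" using c(1) by (auto simp: field_simps)
    then show "g y \<in> {y, y + (1 / c) \<odot> w}" using l by auto
  qed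
  have "inj_on (\<lambda>g. g y) ?S"
  proof (rule inj_onI, rule ext)
    fix g h x assume gh: "g \<in> ?S" "h \<in> ?S" "g y = h y"
    \<comment> \<open>Coordinates of \<open>x\<close> in the basis \<open>y\<close>,
      \<open>w\<close>: the remainder is orthogonal to \<open>w\<close>, hence a multiple of
      it.\<close>
    have "Bt (x + Bt x w \<odot> y) w = 0"
      using y by (simp add: Bt_add_left Bt_scale_left Bt_sym[of y])
    then obtain l where "x + Bt x w \<odot> y = l \<odot> w" by (rule perpE[OF assms(1) \<open>w \<noteq> 0\<close>])
    then have x: "x = Bt x w \<odot> y + l \<odot> w" by (metis v_add_left_cancel add.commute)
    have k: "k x = Bt x w \<odot> k y + l \<odot> w" if "k \<in> ?S" for k
      using S[OF that] x by metis
    show "g x = h x" unfolding k[OF gh(1)] k[OF gh(2)] gh(3) ..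
  qed
  then have "card ?S = card ((\<lambda>g. g y) ` ?S)" by (simp add: card_image)
  also have "\<dots> \<le> card {y, y + (1 / c) \<odot> w}"
    using S(2) by (intro card_mono) blast+
  also have "\<dots> \<le> 2" by (simp add: card_insert_le_m1)
  finally show ?thesis .
qed

text \<open>The stabiliser \<open>K\<close> of one form of \<open>\<Delta>\<close> is transitive on
  the complement, so \<open>card (Q - \<Delta>)\<close> divides its order; on the other forms of
  \<open>\<Delta>\<close> it acts with point stabilisers of order at most 2.\<close>

lemma card_complement_dvd: "card (Q - \<Delta>) dvd 2 * (card \<Delta> - 1)"
proof -
  obtain \<phi> where \<phi>: "\<phi> \<in> \<Delta>" using card_\<Delta> by fastforce
  obtain \<psi> where \<psi>: "\<psi> \<in> Q - \<Delta>" by (rule complement_memberE)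
  define K where "K = {g \<in> G. form_act g \<phi> = \<phi>}"
  have K: "finite K" "\<And>g. g \<in> K \<Longrightarrow> bij g" "\<And>g h. g \<in> K \<Longrightarrow> h \<in> K \<Longrightarrow> g \<circ> h \<in> K"
    "\<And>g. g \<in> K \<Longrightarrow> inv g \<in> K" "id \<in> K"
  proof -
    show "inv g \<in> K" if "g \<in> K" for g
    proof -
      have "form_act (inv g) \<phi> = \<phi>"
        using that G_group(2) form_act_inv_cancel(1)[of g \<phi>] by (simp add: K_def)
      then show ?thesis using that G_group by (simp add: K_def)
    qed
  qed (use G_group in \<open>auto simp: K_def form_act_comp\<close>)
  have orbit: "(\<lambda>g. form_act g \<psi>) ` K = Q - \<Delta>"
  proof
    show "(\<lambda>g. form_act g \<psi>) ` K \<subseteq> Q - \<Delta>"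
    proof clarify
      fix g assume g: "g \<in> K"
      then have gi: "inv g \<in> G" using K(4) by (auto simp: K_def)
      have "form_act g \<psi> \<in> Q" using g G_group Q_inv \<psi> by (auto simp: K_def)
      moreover have "form_act g \<psi> \<notin> \<Delta>"
        using G_group(6)[OF gi, of "form_act g \<psi>"] K(2)[OF g] \<psi> by auto
      ultimately show "form_act g \<psi> \<in> Q - \<Delta>" by blast
    qed
    show "Q - \<Delta> \<subseteq> (\<lambda>g. form_act g \<psi>) ` K"
    proof
      fix \<omega> assume "\<omega> \<in> Q - \<Delta>"
      then obtain g where "g \<in> G" "form_act g \<phi> = \<phi>" "form_act g \<psi> = \<omega>"
        using flag_transitive[OF \<phi> \<psi> \<phi>] by blast
      then show "\<omega> \<in> (\<lambda>g. form_act g \<psi>) ` K" unfolding K_def by blast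
    qed
  qed
  have "card (Q - \<Delta>) dvd card K"
    by (rule dvdI, rule card_orbit_times_card_stabiliser[OF K(1-4), of \<psi>, unfolded orbit])
  also have "card K dvd 2 * card (\<Delta> - {\<phi>})"
  proof (rule card_dvd_two_card_invariant[OF K(1) _ K(2-5)])
    show "form_act g \<omega> \<in> \<Delta> - {\<phi>}" if "g \<in> K" "\<omega> \<in> \<Delta> - {\<phi>}" for g \<omega>
    proof -
      have "form_act g \<omega> \<noteq> form_act g \<phi>"
        using that(2) K(2)[OF that(1)] by (metis DiffD2 form_act_inv_cancel(1) singletonI)
      then show ?thesis using that G_group by (auto simp: K_def)
    qed
    show "card {g \<in> K. form_act g \<omega> = \<omega>} \<le> 2" if "\<omega> \<in> \<Delta> - {\<phi>}" for \<omega>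
      using pair_stabiliser_le_2[of \<phi> \<omega>] that \<phi> \<Delta>_sub by (auto simp: K_def conj_assoc)
  qed simp
  also have "card (\<Delta> - {\<phi>}) = card \<Delta> - 1" using \<phi> by simp
  finally show ?thesis .
qed

text \<open>Each zero \<open>x\<close> of \<open>\<phi>\<close> gives a different form
  \<open>shift \<phi> x\<close> in \<open>Q\<close>, and a plane over a field with at least 8
  elements has enough zeros.\<close>

lemma card_Q_gt_16: "card Q > 16"
proof -
  obtain \<phi> w where w: "\<phi> \<in> \<Delta>" "shift \<phi> w \<in> \<Delta>" "w \<noteq> 0" by (rule codeword_pairE)
  have \<phi>: "\<phi> \<in> Q" "polarises_to \<phi> B" using w(1) \<Delta>_sub Q_pol by auto
  have "b \<ge> 3" using b_ge_2 b_neq_2 by simp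
  then have q: "CARD('q) \<ge> 8" using power_increasing[of 3 b "2::nat"] by (simp add: card_q)
  \<comment> \<open>The functional \<open>Bt x w\<close> of \<open>x\<close> has the line through
    \<open>w\<close> as kernel and the whole field as range, so the space has
    \<open>CARD('q)\<^sup>2\<close> vectors.\<close>
  have "x \<in> range (\<lambda>l. l \<odot> w)" if "Bt x w = 0" for x
    using perpE[OF \<phi>(1) w(3) that] by blast
  then have "{x. Bt x w = 0} = range (\<lambda>l. l \<odot> w)" by (auto simp: Bt_scale_left)
  moreover have "inj (\<lambda>l. l \<odot> w)"
  proof (rule injI)
    fix l k assume "l \<odot> w = k \<odot> w"
    then have "(l + k) \<odot> w = 0" by simp
    then show "l = k" using w(3) by (metis scale_eq_0_iff q_add_eq_0_iff)
  qed
  ultimately have ker: "card {x. Bt x w = 0} = CARD('q)" by (simp add: card_image)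
  obtain y where y: "Bt w y = 1" using w(3) by (rule ex_Bt_eq_1)
  have "a = Bt (a \<odot> y) w" for a using y by (simp add: Bt_scale_left Bt_sym[of y])
  then have "range (\<lambda>x. Bt x w) = UNIV" by (metis surjI)
  then have "CARD(bit^'d) = CARD('q) * CARD('q)"
    using card_eq_card_kernel_times_card_range[of "\<lambda>x. Bt x w"] ker by (simp add: Bt_add_left)
  then have "64 \<le> CARD(bit^'d)" using mult_le_mono[OF q q] by simp
  then have "16 < card {x. \<phi> x = 0}"
    by (intro B.card_zeros_quadratic) (rule pol_add[OF \<phi>(2)])
  also have "card {x. \<phi> x = 0} = card (shift \<phi> ` {x. \<phi> x = 0})"
    by (rule card_image[symmetric]) (simp add: inj_on_def shift_inject)
  also have "\<dots> \<le> card Q"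
    using shift_in_Q[OF \<phi>(1)] by (intro card_mono) auto
  finally show ?thesis .
qed

lemma contradiction: False
proof -
  \<comment> \<open>The complement supplies the second of the two mutual divisibilities.\<close>
  interpret C: semilinear_codeword smul Bt B b Q "Q - \<Delta>" by (rule complement)
  have D: "Q - (Q - \<Delta>) = \<Delta>" using \<Delta>_sub by auto
  have "card \<Delta> + card (Q - \<Delta>) \<le> 16"
    using mutual_dvd_imp_sum_le_16 card_\<Delta> card_compl card_complement_dvd
      C.card_complement_dvd by (simp add: D)
  moreover have "card Q = card \<Delta> + card (Q - \<Delta>)"
    using \<Delta>_sub by (simp add: card_Diff_subset card_mono)
  ultimately show False using card_Q_gt_16 by simp
qed

end

section \<open>From the code to a single semilinear codeword\<close>

theorem theorem6p12:
  fixes n k :: nat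
    and B :: "bit^'d \<Rightarrow> bit^'d \<Rightarrow> bit"
    and \<epsilon> :: form_type
    and \<Gamma> :: "(bit^'d \<Rightarrow> bit) set set"
    and \<Delta> :: "(bit^'d \<Rightarrow> bit) set"
  assumes "n \<ge> 2"
    and "CARD('d) = 2 * n"
    and "symplectic_form (*s) B"
    and "2 \<le> k" and "k + 2 \<le> card (quadratic_forms B \<epsilon>)"
    and "johnson_code (quadratic_forms B \<epsilon>) k \<Gamma>"
    and "strongly_incidence_transitive (isometry_group B) (quadratic_forms B \<epsilon>) \<Gamma>"
    and "\<Delta> \<in> \<Gamma>"
    and "irreducible_on_space (set_stabiliser (isometry_group B) \<Delta>)"
  shows "\<not> (\<exists>H. maximal_C3_subgroup TYPE('q::{field,finite}) B H \<and>
                set_stabiliser (isometry_group B) \<Delta> \<subseteq> H)"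
proof
  let ?Q = "quadratic_forms B \<epsilon>"
  assume "\<exists>H. maximal_C3_subgroup TYPE('q) B H \<and> set_stabiliser (isometry_group B) \<Delta> \<subseteq> H"
  then obtain b and smul :: "'q \<Rightarrow> bit^'d \<Rightarrow> bit^'d" and Bt :: "bit^'d \<Rightarrow> bit^'d \<Rightarrow> 'q" where
    H: "prime b" "CARD('q) = 2 ^ b" "vector_space smul" "symplectic_form smul Bt"
      "\<And>u v. of_bit (B u v) = absolute_trace b (Bt u v)"
      "set_stabiliser (isometry_group B) \<Delta> \<subseteq> semisymplectic_group smul Bt"
    unfolding maximal_C3_subgroup_def by blast
  have \<Delta>: "\<Delta> \<subseteq> ?Q" "card \<Delta> = k"
    using assms(6,8) by (auto simp: johnson_code_def)
  \<comment> \<open>With the ambient space interpreted first, only the conditions on the codeword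
    remain to be shown.\<close>
  interpret symplectic_trace_space smul Bt B b
    by (rule symplectic_trace_space.intro) (fact H assms(3))+
  have "semilinear_codeword smul Bt B b ?Q \<Delta>"
  proof
    show "2 \<le> card (?Q - \<Delta>)"
      using assms(5) \<Delta> by (simp add: card_Diff_subset)
    show "\<exists>g\<in>set_stabiliser (isometry_group B) \<Delta>. form_act g \<phi> = \<phi>' \<and> form_act g \<psi> = \<psi>'"
      if "\<phi> \<in> \<Delta>" "\<psi> \<in> ?Q - \<Delta>" "\<phi>' \<in> \<Delta>" "\<psi>' \<in> ?Q - \<Delta>" for \<phi> \<psi> \<phi>' \<psi>'
    proof -
      have "\<forall>(\<phi>, \<psi>) \<in> \<Delta> \<times> (?Q - \<Delta>). \<forall>(\<phi>', \<psi>') \<in> \<Delta> \<times> (?Q - \<Delta>).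
          \<exists>g\<in>set_stabiliser (isometry_group B) \<Delta>. form_act g \<phi> = \<phi>' \<and> form_act g \<psi> = \<psi>'"
        using assms(8) assms(7)[unfolded strongly_incidence_transitive_def]
        by (elim conjE) (rule bspec)
      from bspec[OF this, of "(\<phi>, \<psi>)"] that(1,2)
      have "\<forall>(\<phi>', \<psi>') \<in> \<Delta> \<times> (?Q - \<Delta>).
          \<exists>g\<in>set_stabiliser (isometry_group B) \<Delta>. form_act g \<phi> = \<phi>' \<and> form_act g \<psi> = \<psi>'"
        by simp
      from bspec[OF this, of "(\<phi>', \<psi>')"] that(3,4) show ?thesis by simp
    qed
    show "polarises_to \<phi> B" if "\<phi> \<in> ?Q" for \<phi>
      using that by (simp add: quadratic_forms_def)
    show "2 \<le> card \<Delta>" using assms(4) \<Delta>(2) by simp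
  qed (fact H \<Delta> quadratic_forms_form_act)+
  then show False by (rule semilinear_codeword.contradiction)
qed

end
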